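(* Suppose that $\lim_{n\to\infty}\sqrt n(1-\lambda^{(n)})=\beta$ for some constant $\beta>0$, that $\lim_{n\to\infty}\sqrt n\left|N_j^{(n)}/n-\gamma_j\right|=0$ for every $j\in\{1,\dots,M\}$, and that $Y^{(n)}_{[1,M-1],1}(0)\Rightarrow Y_{[1,M-1],1}(0)$ as $n\to\infty$, where $Y_{[1,M-1],1}(0)$ is a proper (a.s. finite) random variable. Then for any $\epsilon>0$, $t_0>0$ and $T\ge t_0$, $$\mathbb P\left(\sup_{s\in[t_0,T]}\left|Y^{(n)}_{[1,M-1],1}(s)\right|>\epsilon\right)\to 0\quad\text{as } n\to\infty .$$ Moreover, if $Y^{(n)}_{[1,M-1],1}(0)\Rightarrow 0$, then the same convergence also holds for $t_0=0$.
   Context: System: $M\ge 2$ server types (pools) with speeds $\mu_1>\mu_2>\dots>\mu_M>0$ and constants $\gamma_j>0$ with $\sum_{j=1}^M\mu_j\gamma_j=1$. The $n$th system has $n$ parallel servers, $N_j^{(n)}$ of type $j$, $\sum_{j=1}^M N_j^{(n)}=n$. Each server has its own queue of infinite buffer and serves jobs First-Come-First-Served. Jobs arrive according to a Poisson process of rate $n\lambda^{(n)}$ with $\lambda^{(n)}<1$; the service time of a job at a type-$j$ server is exponential with rate $\mu_j$, independently of everything else. Each job is irrevocably assigned upon arrival to a server by the Speed-Aware Join-the-Shortest-Queue (SA-JSQ) policy: it joins a server with the minimum queue length (number of jobs at that server) among all servers; ties between servers of different types are broken in favour of the type with the largest speed, and ties between servers of the same type are broken uniformly at random. $Q^{(n)}_{j,i}(t)$,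 $i\ge1$, denotes the number of type-$j$ servers with at least $i$ jobs at time $t$ in the $n$th system. Scaled processes: $Y^{(n)}_{j,1}(t)=(Q^{(n)}_{j,1}(t)-N_j^{(n)})/\sqrt n$, and $Y^{(n)}_{[1,M-1],1}(t)=\sum_{j=1}^{M-1}Y^{(n)}_{j,1}(t)$. The symbol $\Rightarrow$ denotes weak convergence. *)

theory Defs
  imports "HOL-Probability.Probability"
begin

text \<open>
  Servers are pairs \<open>(j, i)\<close>: the \<open>i\<close>-th server of type \<open>j\<close>, with types numbered \<open>1, \<dots>, M\<close> and,
  within a type, servers numbered from \<open>0\<close>.
\<close>

type_synonym server = "nat \<times> nat"

definition servers :: "nat \<Rightarrow> (nat \<Rightarrow> nat) \<Rightarrow> server set" where
  "servers M N = (SIGMA j:{1..M}. {..<N j})"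

text \<open>
  The real-valued random inputs of one system. Arriving jobs are numbered from \<open>0\<close>.
  \<^item> \<open>Gap k\<close>: time between the arrivals of jobs \<open>k - 1\<close> and \<open>k\<close> (for \<open>k = 0\<close>: time until the first
    arrival);
  \<^item> \<open>Service k j\<close>: service time of arriving job \<open>k\<close> if it is assigned to a server of type \<open>j\<close>;
  \<^item> \<open>Initial_Service s l\<close>: service time of the \<open>l\<close>-th job present at server \<open>s\<close> at time \<open>0\<close>; for
    \<open>l = 0\<close>, the job at the head of the queue, this is the service time remaining at time \<open>0\<close>,
    which has the same exponential law;
  \<^item> \<open>Tie k\<close>: randomization used to break ties when job \<open>k\<close> is assigned.
\<close>

datatype input = Gap nat | Service nat nat | Initial_Service server nat | Tie nat

text \<open>The Speed-Aware Join-the-Shortest-Queue policy\<close>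

definition shortest :: "server set \<Rightarrow> (server \<Rightarrow> nat) \<Rightarrow> server set" where
  "shortest S x = {s \<in> S. \<forall>s'\<in>S. x s \<le> x s'}"

definition fastest_shortest ::
  "(nat \<Rightarrow> real) \<Rightarrow> server set \<Rightarrow> (server \<Rightarrow> nat) \<Rightarrow> server set" where
  "fastest_shortest \<mu> S x =
     {s \<in> shortest S x. \<forall>s'\<in>shortest S x. \<mu> (fst s') \<le> \<mu> (fst s)}"

text \<open>
  For finite nonempty \<open>C\<close>, \<^const>\<open>from_nat_into\<close> \<open>C\<close> is a bijection from \<open>{..<card C}\<close> to \<open>C\<close>. Hence,
  if \<open>u\<close> is uniform on \<open>[0,1)\<close>, the chosen server is uniform among the candidates.
\<close>

definition sa_jsq :: "(nat \<Rightarrow> real) \<Rightarrow> server set \<Rightarrow> (server \<Rightarrow> nat) \<Rightarrow> real \<Rightarrow> server" where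
  "sa_jsq \<mu> S x u =
     (let C = fastest_shortest \<mu> S x in from_nat_into C (nat \<lfloor>u * real (card C)\<rfloor>))"

text \<open>Sample paths, as functions of the initial queue lengths \<open>x0\<close> and of the inputs \<open>w\<close>\<close>

definition arrival_time :: "(input \<Rightarrow> real) \<Rightarrow> nat \<Rightarrow> real" where
  "arrival_time w k = (\<Sum>i\<le>k. w (Gap i))"

text \<open>
  First-Come-First-Served: a job arriving at time \<open>t\<close> at a server whose earlier jobs depart at the
  times \<open>ds\<close> (in order of arrival) starts service as soon as it has arrived and the preceding job
  has left.
\<close>

definition fcfs_departure :: "real \<Rightarrow> real list \<Rightarrow> real \<Rightarrow> real" where
  "fcfs_departure t ds v = (if ds = [] then t else max t (last ds)) + v"

text \<open>
  \<open>departures \<mu> S x0 w k s\<close> lists the departure times of all jobs ever assigned to server \<open>s\<close> among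
  the initial jobs and the first \<open>k\<close> arriving jobs, in order of arrival. Job \<open>k\<close> is assigned on the
  basis of the queue lengths just before its arrival time \<open>t\<close>: it finds there the earlier jobs
  whose departure time is not before \<open>t\<close>.
\<close>

primrec departures ::
  "(nat \<Rightarrow> real) \<Rightarrow> server set \<Rightarrow> (server \<Rightarrow> nat) \<Rightarrow> (input \<Rightarrow> real) \<Rightarrow> nat \<Rightarrow> server \<Rightarrow> real list" where
  "departures \<mu> S x0 w 0 =
     (\<lambda>s. map (\<lambda>l. \<Sum>i\<le>l. w (Initial_Service s i)) [0..<x0 s])"
| "departures \<mu> S x0 w (Suc k) =
     (let D = departures \<mu> S x0 w k;
          t = arrival_time w k;
          r = sa_jsq \<mu> S (\<lambda>s. length (filter (\<lambda>d. t \<le> d) (D s))) (w (Tie k))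
      in D(r := D r @ [fcfs_departure t (D r) (w (Service k (fst r)))]))"

definition num_arrivals :: "(input \<Rightarrow> real) \<Rightarrow> real \<Rightarrow> nat" where
  "num_arrivals w t = card {k. arrival_time w k \<le> t}"

definition queue_length ::
  "(nat \<Rightarrow> real) \<Rightarrow> server set \<Rightarrow> (server \<Rightarrow> nat) \<Rightarrow> (input \<Rightarrow> real) \<Rightarrow> real \<Rightarrow> server \<Rightarrow> nat" where
  "queue_length \<mu> S x0 w t s =
     length (filter (\<lambda>d. t < d) (departures \<mu> S x0 w (num_arrivals w t) s))"

text \<open>\<open>Q\<^sub>j\<^sub>,\<^sub>i(t)\<close>\<close>

definition Q_proc ::
  "nat \<Rightarrow> (nat \<Rightarrow> real) \<Rightarrow> (nat \<Rightarrow> nat) \<Rightarrow> (server \<Rightarrow> nat) \<Rightarrow> (input \<Rightarrow> real) \<Rightarrow>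
    nat \<Rightarrow> nat \<Rightarrow> real \<Rightarrow> nat" where
  "Q_proc M \<mu> N x0 w j i t =
     card {s \<in> servers M N. fst s = j \<and> i \<le> queue_length \<mu> (servers M N) x0 w t s}"

text \<open>\<open>Y\<^sub>j\<^sub>,\<^sub>1(t)\<close> in the system with \<open>n\<close> servers, and its sum over the types \<open>1, \<dots>, M - 1\<close>\<close>

definition Y1_proc ::
  "nat \<Rightarrow> (nat \<Rightarrow> real) \<Rightarrow> nat \<Rightarrow> (nat \<Rightarrow> nat) \<Rightarrow> (server \<Rightarrow> nat) \<Rightarrow> (input \<Rightarrow> real) \<Rightarrow>
    nat \<Rightarrow> real \<Rightarrow> real" where
  "Y1_proc M \<mu> n N x0 w j t = (real (Q_proc M \<mu> N x0 w j 1 t) - real (N j)) / sqrt (real n)"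

definition Y1_fast ::
  "nat \<Rightarrow> (nat \<Rightarrow> real) \<Rightarrow> nat \<Rightarrow> (nat \<Rightarrow> nat) \<Rightarrow> (server \<Rightarrow> nat) \<Rightarrow> (input \<Rightarrow> real) \<Rightarrow> real \<Rightarrow> real" where
  "Y1_fast M \<mu> n N x0 w t = (\<Sum>j = 1..M - 1. Y1_proc M \<mu> n N x0 w j t)"

text \<open>
  The probabilistic assumptions on one system with total arrival rate \<open>a\<close>. The initial queue lengths
  at different servers may be arbitrarily dependent, but are independent of the inputs (the
  \<open>\<sigma>\<close>-algebras generated by the two families are independent). Independent
  exponential interarrival times of rate \<open>a\<close> make the arrivals a Poisson process of rate \<open>a\<close>.
\<close>

definition sa_jsq_system ::
  "nat \<Rightarrow> (nat \<Rightarrow> real) \<Rightarrow> (nat \<Rightarrow> nat) \<Rightarrow> real \<Rightarrow> 'a measure \<Rightarrow>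
    ('a \<Rightarrow> server \<Rightarrow> nat) \<Rightarrow> (input \<Rightarrow> 'a \<Rightarrow> real) \<Rightarrow> bool" where
  "sa_jsq_system M \<mu> N a P X0 W \<longleftrightarrow>
     prob_space P \<and>
     prob_space.indep_vars P (\<lambda>_. borel) W UNIV \<and>
     (\<lambda>\<omega>. restrict (X0 \<omega>) (servers M N)) \<in> P \<rightarrow>\<^sub>M PiM (servers M N) (\<lambda>_. count_space UNIV) \<and>
     prob_space.indep_set P
       (sets (vimage_algebra (space P) (\<lambda>\<omega>. restrict (X0 \<omega>) (servers M N))
                (PiM (servers M N) (\<lambda>_. count_space UNIV))))
       (sets (vimage_algebra (space P) (\<lambda>\<omega> i. W i \<omega>) (PiM UNIV (\<lambda>_. borel)))) \<and>
     (\<forall>k. distributed P lborel (W (Gap k)) (exponential_density a)) \<and>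
     (\<forall>k. \<forall>j\<in>{1..M}. distributed P lborel (W (Service k j)) (exponential_density (\<mu> j))) \<and>
     (\<forall>s\<in>servers M N. \<forall>l.
        distributed P lborel (W (Initial_Service s l)) (exponential_density (\<mu> (fst s)))) \<and>
     (\<forall>k. distr P borel (W (Tie k)) = uniform_measure lborel {0..<1})"

end

theory Submission
  imports Defs "HOL-Real_Asymp.Real_Asymp"
begin

text \<open>
  Call the servers of the types \<open>1, \<dots>, M - 1\<close> fast, and let \<open>I(t)\<close> be the number of idle fast
  servers; then the process of the theorem is \<open>- I / sqrt n\<close>. As long as \<open>I > 0\<close>, the policy sends every
  arriving job to an idle fast server, so that \<open>I\<close> decreases at rate \<open>n \<lambda>\<close>, which is close to \<open>n\<close>. It
  increases only when a fast server completes a job, and all fast servers together work at rate at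
  most \<open>R = (\<Sum>j<M. \<mu>\<^sub>j N\<^sub>j)\<close>, which is close to \<open>n b\<close> for the load \<open>b = 1 - \<mu>\<^sub>M \<gamma>\<^sub>M < 1\<close>. Thus \<open>I\<close> is dominated
  by a reflected random walk with a strictly negative drift of order \<open>n\<close>: an excursion of \<open>I\<close> to height
  \<open>\<epsilon> sqrt n\<close> has a probability exponentially small in \<open>sqrt n\<close>, which beats the polynomial number of
  possible excursions in a bounded time, and an initial value of order \<open>sqrt n\<close> is used up within a
  time of order \<open>1 / sqrt n\<close>, hence before any fixed \<open>t0 > 0\<close>.

  The pathwise part is a Lindley recursion along the arrivals. Let \<open>e\<^sub>j\<close> be the sum of the first \<open>j\<close>
  interarrival times. Just before the arrival at time \<open>e\<^sub>m\<^sub>+\<^sub>1\<close> the number of idle fast servers is at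
  most the number of departures from fast servers during \<open>[e\<^sub>j, e\<^sub>m\<^sub>+\<^sub>1]\<close> minus \<open>m - j\<close>, for some \<open>j \<le> m\<close>, plus
  the initial number if \<open>j = 0\<close> (\<open>lindley_bound\<close>).

  The probabilistic part bounds the exponential moments of these numbers of departures by those of a
  Poisson process of rate \<open>R\<close> (\<open>num_departures_mgf_le\<close>). It avoids Markov processes and filtrations in
  time. If a job has an exponential service time \<open>v\<close> of rate \<open>m\<close> and starts service at time \<open>\<sigma>\<close>, then
  for every \<open>z \<ge> 1\<close> the factor
  \<open>z\<close> (if it departs during \<open>[u, t]\<close>) times \<open>exp (- (z - 1) m \<cdot> length of service within [u, t])\<close>
  has mean one (\<open>nn_integral_job_weight_le_1\<close>). Under first-come-first-served the start \<open>\<sigma>\<close> is determined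
  by the arrival times and by the service times of earlier jobs. So the jobs can be integrated out one
  after the other, from the last one to the first one, all arrival times being kept fixed
  (\<open>service_step\<close>, \<open>initial_step\<close>). The product of all factors therefore has mean at most one, and since
  the service intervals at one server are disjoint, the total exponent is at most
  \<open>(z - 1) R (t - u)\<close>. For \<open>u = e\<^sub>j\<close> and \<open>t = e\<^sub>m\<close> it remains to take the exponential moment of
  \<open>e\<^sub>m - e\<^sub>j\<close>, which is explicit.

  Chernoff bounds and a union bound over the pairs \<open>j \<le> m\<close> give an estimate for one system
  (\<open>system_exceedance_bound\<close>). As \<open>n\<close> grows, all its terms vanish except the probability of an initial
  value below \<open>- \<kappa>\<close>, which tightness of the initial values makes small by the choice of \<open>\<kappa>\<close>.
\<close>

section \<open>Idle fast servers along a sample path\<close>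

text \<open>
  With \<open>epoch w 0 = 0\<close>, the arrivals and the initial time are treated alike: job \<open>k\<close> arrives at
  \<open>epoch w (Suc k)\<close>, and \<open>k\<close> jobs have arrived during \<open>[epoch w k, epoch w (Suc k))\<close>.
\<close>

definition epoch :: "(input \<Rightarrow> real) \<Rightarrow> nat \<Rightarrow> real" where
  "epoch w j = (\<Sum>i<j. w (Gap i))"

lemma arrival_time_eq_epoch: "arrival_time w k = epoch w (Suc k)"
  by (simp add: arrival_time_def epoch_def lessThan_Suc_atMost)

definition assigned ::
  "(nat \<Rightarrow> real) \<Rightarrow> server set \<Rightarrow> (server \<Rightarrow> nat) \<Rightarrow> (input \<Rightarrow> real) \<Rightarrow> nat \<Rightarrow> server" where
  "assigned \<mu> S x0 w k =
     sa_jsq \<mu> S (\<lambda>s. length (filter (\<lambda>d. arrival_time w k \<le> d) (departures \<mu> S x0 w k s))) (w (Tie k))"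

lemma departures_Suc_eq:
  "departures \<mu> S x0 w (Suc k) s =
     (if s = assigned \<mu> S x0 w k
      then departures \<mu> S x0 w k s @
        [fcfs_departure (arrival_time w k) (departures \<mu> S x0 w k s) (w (Service k (fst s)))]
      else departures \<mu> S x0 w k s)"
  by (simp add: assigned_def Let_def)

lemma finite_servers [simp]: "finite (servers M N)"
  by (simp add: servers_def)

lemma servers_mono: "m \<le> M \<Longrightarrow> servers m N \<subseteq> servers M N"
  by (auto simp: servers_def)

lemma sum_servers: "(\<Sum>s\<in>servers M N. f (fst s)) = (\<Sum>j = 1..M. real (N j) * f j)"
proof -
  have "(\<Sum>j = 1..M. \<Sum>i<N j. f j) = (\<Sum>(j, i)\<in>servers M N. f j)"
    unfolding servers_def by (rule sum.Sigma) auto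
  then show ?thesis by (simp add: case_prod_unfold)
qed

lemma fastest_shortest_nonempty:
  assumes "finite S" "S \<noteq> {}"
  shows "fastest_shortest \<mu> S x \<noteq> {}"
proof -
  have "shortest S x \<noteq> {}"
  proof -
    obtain s where "s \<in> S" "x s = Min (x ` S)"
      using assms Min_in[of "x ` S"] by fastforce
    then have "s \<in> shortest S x" using assms by (auto simp: shortest_def)
    then show ?thesis by auto
  qed
  moreover have "finite (shortest S x)" using assms by (auto simp: shortest_def)
  ultimately obtain s where "s \<in> shortest S x" "\<mu> (fst s) = Max ((\<lambda>s. \<mu> (fst s)) ` shortest S x)"
    using Max_in[of "(\<lambda>s. \<mu> (fst s)) ` shortest S x"] by fastforce
  then have "s \<in> fastest_shortest \<mu> S x"
    using \<open>finite (shortest S x)\<close> by (auto simp: fastest_shortest_def)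
  then show ?thesis by auto
qed

lemma sa_jsq_in:
  assumes "finite S" "S \<noteq> {}"
  shows "sa_jsq \<mu> S x u \<in> fastest_shortest \<mu> S x"
  unfolding sa_jsq_def Let_def
  by (rule from_nat_into[OF fastest_shortest_nonempty[OF assms]])

lemma sa_jsq_in_servers:
  assumes "finite S" "S \<noteq> {}"
  shows "sa_jsq \<mu> S x u \<in> S"
  using sa_jsq_in[OF assms, of \<mu> x u] by (auto simp: fastest_shortest_def shortest_def)

text \<open>
  The property of the policy behind the negative drift. The minimal queue length
  is \<open>0\<close>, and among the idle servers the policy takes one of the largest speed, which cannot be of
  the slowest type \<open>M\<close>.
\<close>

lemma sa_jsq_prefers_idle_fast:
  assumes dec: "\<And>i j. 1 \<le> i \<Longrightarrow> i < j \<Longrightarrow> j \<le> M \<Longrightarrow> \<mu> j < \<mu> i"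
    and s: "s \<in> servers (M - 1) N" "x s = 0"
  shows "sa_jsq \<mu> (servers M N) x u \<in> servers (M - 1) N" "x (sa_jsq \<mu> (servers M N) x u) = 0"
proof -
  let ?r = "sa_jsq \<mu> (servers M N) x u"
  have sM: "s \<in> servers M N" using s servers_mono[of "M - 1" M N] by auto
  then have r: "?r \<in> fastest_shortest \<mu> (servers M N) x"
    by (intro sa_jsq_in) auto
  then show x0: "x ?r = 0"
    using s sM by (auto simp: fastest_shortest_def shortest_def)
  have "s \<in> shortest (servers M N) x" using s sM by (auto simp: shortest_def)
  then have le: "\<mu> (fst s) \<le> \<mu> (fst ?r)" using r by (auto simp: fastest_shortest_def)
  have rM: "?r \<in> servers M N" using r by (auto simp: fastest_shortest_def shortest_def)
  have "1 \<le> fst s" "fst s < M" using s by (auto simp: servers_def)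
  then have "fst ?r \<noteq> M"
    using le dec[of "fst s" M] by auto
  then show "?r \<in> servers (M - 1) N" using rM by (auto simp: servers_def)
qed

definition positive_inputs :: "nat \<Rightarrow> (nat \<Rightarrow> nat) \<Rightarrow> (input \<Rightarrow> real) \<Rightarrow> bool" where
  "positive_inputs M N w \<longleftrightarrow> (\<forall>k. 0 < w (Gap k)) \<and> (\<forall>k. \<forall>j\<in>{1..M}. 0 < w (Service k j)) \<and>
     (\<forall>s\<in>servers M N. \<forall>l. 0 < w (Initial_Service s l))"

text \<open>
  Departures are counted in the lists of all jobs assigned so far, whether or not the departure
  lies in the future. A later \<open>k\<close> thus only adds departures, and one large \<open>k\<close> serves all times.
\<close>

definition num_departures ::
  "nat \<Rightarrow> (nat \<Rightarrow> real) \<Rightarrow> (nat \<Rightarrow> nat) \<Rightarrow> (server \<Rightarrow> nat) \<Rightarrow> (input \<Rightarrow> real) \<Rightarrow> nat \<Rightarrow> (real \<Rightarrow> bool) \<Rightarrow> nat" where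
  "num_departures M \<mu> N x0 w k Q =
     (\<Sum>s\<in>servers (M - 1) N. length (filter Q (departures \<mu> (servers M N) x0 w k s)))"

definition idle_fast ::
  "nat \<Rightarrow> (nat \<Rightarrow> real) \<Rightarrow> (nat \<Rightarrow> nat) \<Rightarrow> (server \<Rightarrow> nat) \<Rightarrow> (input \<Rightarrow> real) \<Rightarrow> real \<Rightarrow> nat" where
  "idle_fast M \<mu> N x0 w t =
     card {s \<in> servers (M - 1) N. queue_length \<mu> (servers M N) x0 w t s = 0}"

lemma Y1_fast_eq_idle_fast:
  assumes "M \<ge> 1"
  shows "Y1_fast M \<mu> n N x0 w t = - real (idle_fast M \<mu> N x0 w t) / sqrt (real n)"
proof -
  let ?q = "queue_length \<mu> (servers M N) x0 w t"
  have *: "real (Q_proc M \<mu> N x0 w j 1 t) - real (N j)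
      = - real (card {i \<in> {..<N j}. ?q (j, i) = 0})" if j: "j \<in> {1..M - 1}" for j
  proof -
    have "{s \<in> servers M N. fst s = j \<and> 1 \<le> ?q s} = Pair j ` {i \<in> {..<N j}. 1 \<le> ?q (j, i)}"
      using j by (auto simp: servers_def)
    then have "Q_proc M \<mu> N x0 w j 1 t = card {i \<in> {..<N j}. 1 \<le> ?q (j, i)}"
      by (simp add: Q_proc_def card_image inj_on_def)
    moreover have "card {i \<in> {..<N j}. 1 \<le> ?q (j, i)} + card {i \<in> {..<N j}. ?q (j, i) = 0}
        = card ({i \<in> {..<N j}. 1 \<le> ?q (j, i)} \<union> {i \<in> {..<N j}. ?q (j, i) = 0})"
      by (subst card_Un_disjoint) auto
    moreover have "{i \<in> {..<N j}. 1 \<le> ?q (j, i)} \<union> {i \<in> {..<N j}. ?q (j, i) = 0} = {..<N j}"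
      by auto
    ultimately show ?thesis by simp
  qed
  have "{s \<in> servers (M - 1) N. ?q s = 0} = (SIGMA j:{1..M - 1}. {i \<in> {..<N j}. ?q (j, i) = 0})"
    by (auto simp: servers_def)
  then have "idle_fast M \<mu> N x0 w t = (\<Sum>j = 1..M - 1. card {i \<in> {..<N j}. ?q (j, i) = 0})"
    by (simp add: idle_fast_def)
  then have "real (idle_fast M \<mu> N x0 w t) = (\<Sum>j = 1..M - 1. real (card {i \<in> {..<N j}. ?q (j, i) = 0}))"
    by simp
  moreover have "Y1_fast M \<mu> n N x0 w t
      = (\<Sum>j = 1..M - 1. - (real (card {i \<in> {..<N j}. ?q (j, i) = 0}) / sqrt (real n)))"
    unfolding Y1_fast_def Y1_proc_def by (intro sum.cong refl) (subst *, auto)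
  ultimately show ?thesis by (simp add: sum_negf flip: sum_divide_distrib)
qed

lemma num_departures_mono:
  assumes "k \<le> K"
  shows "num_departures M \<mu> N x0 w k Q \<le> num_departures M \<mu> N x0 w K Q"
  using assms
proof (induction rule: dec_induct)
  case (step i)
  have "num_departures M \<mu> N x0 w i Q \<le> num_departures M \<mu> N x0 w (Suc i) Q"
    unfolding num_departures_def by (intro sum_mono) (simp only: departures_Suc_eq, simp)
  with step show ?case by simp
qed simp

lemma num_departures_add:
  assumes "u \<le> v" "v \<le> (t :: real)"
  shows "num_departures M \<mu> N x0 w k (\<lambda>d. u \<le> d \<and> d < v) + num_departures M \<mu> N x0 w k (\<lambda>d. v \<le> d \<and> d < t)
     = num_departures M \<mu> N x0 w k (\<lambda>d. u \<le> d \<and> d < t)"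
proof -
  have "length (filter (\<lambda>d. u \<le> d \<and> d < v) ds) + length (filter (\<lambda>d. v \<le> d \<and> d < t) ds)
    = length (filter (\<lambda>d. u \<le> d \<and> d < t) ds)" for ds
    using assms by (induction ds) auto
  then show ?thesis by (simp add: num_departures_def flip: sum.distrib)
qed

lemma card_servers_le_num_departures:
  "card {s \<in> servers (M - 1) N. \<exists>d\<in>set (departures \<mu> (servers M N) x0 w k s). Q d}
     \<le> num_departures M \<mu> N x0 w k Q"
proof -
  let ?F = "servers (M - 1) N" and ?D = "departures \<mu> (servers M N) x0 w k"
  have "card {s \<in> ?F. \<exists>d\<in>set (?D s). Q d} = (\<Sum>s\<in>?F. if \<exists>d\<in>set (?D s). Q d then 1 else 0)"
    by (simp add: sum.If_cases Int_def)
  also have "\<dots> \<le> (\<Sum>s\<in>?F. length (filter Q (?D s)))"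
    by (intro sum_mono) (auto simp: Suc_le_eq filter_empty_conv)
  finally show ?thesis by (simp add: num_departures_def)
qed

locale positive_path =
  fixes M :: nat and \<mu> :: "nat \<Rightarrow> real" and N :: "nat \<Rightarrow> nat" and x0 :: "server \<Rightarrow> nat"
    and w :: "input \<Rightarrow> real"
  assumes pos: "positive_inputs M N w"
    and speeds: "\<And>i j. 1 \<le> i \<Longrightarrow> i < j \<Longrightarrow> j \<le> M \<Longrightarrow> \<mu> j < \<mu> i"
    and nonempty: "servers M N \<noteq> {}"
begin

abbreviation "S \<equiv> servers M N"
abbreviation "F \<equiv> servers (M - 1) N"
abbreviation "D \<equiv> departures \<mu> S x0 w"

lemma strict_mono_epoch: "strict_mono (epoch w)"
  by (rule strict_monoI_Suc) (use pos in \<open>simp add: epoch_def positive_inputs_def\<close>)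

lemma epoch_le_iff: "epoch w i \<le> epoch w j \<longleftrightarrow> i \<le> j"
  using strict_mono_epoch by (simp add: strict_mono_less_eq)

lemma epoch_0 [simp]: "epoch w 0 = 0"
  by (simp add: epoch_def)

lemma num_arrivals_eq:
  assumes "epoch w m \<le> t" "t < epoch w (Suc m)"
  shows "num_arrivals w t = m"
proof -
  have "arrival_time w k \<le> t \<longleftrightarrow> k < m" for k
    unfolding arrival_time_eq_epoch
    using assms epoch_le_iff[of "Suc k" m] epoch_le_iff[of "Suc m" "Suc k"] by force
  then have "{k. arrival_time w k \<le> t} = {..<m}" by auto
  then show ?thesis by (simp add: num_arrivals_def)
qed

lemma epoch_bracket:
  assumes "0 \<le> t" "t < epoch w K"
  shows "\<exists>m<K. epoch w m \<le> t \<and> t < epoch w (Suc m)"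
  using assms
proof (induction K)
  case (Suc K)
  then show ?case by (cases "t < epoch w K") (auto simp: less_Suc_eq)
qed simp

lemma assigned_in_S: "assigned \<mu> S x0 w k \<in> S"
  unfolding assigned_def using nonempty by (intro sa_jsq_in_servers) auto

text \<open>
  The number of idle fast servers found by job \<open>m\<close> upon its arrival at \<open>epoch w (Suc m)\<close>.
\<close>

definition idle_before :: "nat \<Rightarrow> nat" where
  "idle_before m = card {s \<in> F. \<forall>d\<in>set (D m s). d < epoch w (Suc m)}"

lemma idle_before_0_le:
  "idle_before 0 \<le> card {s \<in> F. x0 s = 0} + num_departures M \<mu> N x0 w 0 (\<lambda>d. epoch w 0 \<le> d \<and> d < epoch w 1)"
proof -
  let ?Q = "\<lambda>d. epoch w 0 \<le> d \<and> d < epoch w 1"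
  have "{s \<in> F. \<forall>d\<in>set (D 0 s). d < epoch w (Suc 0)} \<subseteq>
     {s \<in> F. x0 s = 0} \<union> {s \<in> F. \<exists>d\<in>set (D 0 s). ?Q d}"
  proof safe
    fix s assume s: "s \<in> F" "\<forall>d\<in>set (D 0 s). d < epoch w (Suc 0)"
      and no: "\<not> (\<exists>d\<in>set (D 0 s). ?Q d)"
    have "s \<in> S" using s(1) servers_mono[of "M - 1" M N] by auto
    then have "0 \<le> w (Initial_Service s i)" for i
      using pos by (simp add: positive_inputs_def less_imp_le)
    then have nonneg: "0 \<le> d" if "d \<in> set (D 0 s)" for d
      using that by (auto intro!: sum_nonneg)
    have "set (D 0 s) = {}"
      using s(2) no nonneg by fastforce
    then show "x0 s = 0" by simp
  qed
  then have "idle_before 0 \<le> card ({s \<in> F. x0 s = 0} \<union> {s \<in> F. \<exists>d\<in>set (D 0 s). ?Q d})"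
    unfolding idle_before_def by (intro card_mono) auto
  also have "\<dots> \<le> card {s \<in> F. x0 s = 0} + card {s \<in> F. \<exists>d\<in>set (D 0 s). ?Q d}"
    by (rule card_Un_le)
  finally show ?thesis
    using card_servers_le_num_departures[where Q = ?Q and k = 0 and M = M and N = N and \<mu> = \<mu> and ?x0.0 = x0 and w = w]
    by linarith
qed

text \<open>
  The Lindley recursion. Job \<open>m\<close> occupies an idle fast server if there is one, which removes one
  server from the count (the subtraction of natural numbers covers the other case). Every fast server
  that is idle at the next arrival without having been idle before has had a departure in between.
\<close>

lemma idle_before_Suc_le:
  "idle_before (Suc m) \<le> (idle_before m - 1)
     + num_departures M \<mu> N x0 w (Suc m) (\<lambda>d. epoch w (Suc m) \<le> d \<and> d < epoch w (Suc (Suc m)))"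
proof -
  let ?Q = "\<lambda>d. epoch w (Suc m) \<le> d \<and> d < epoch w (Suc (Suc m))"
  let ?r = "assigned \<mu> S x0 w m"
  let ?A = "{s \<in> F. \<forall>d\<in>set (D m s). d < epoch w (Suc m)}"
  have new: "D (Suc m) ?r = D m ?r @ [fcfs_departure (arrival_time w m) (D m ?r) (w (Service m (fst ?r)))]"
    by (simp only: departures_Suc_eq if_True simp_thms)
  have "0 < w (Service m (fst ?r))"
    using pos assigned_in_S[of m] by (auto simp: positive_inputs_def servers_def)
  then have late: "epoch w (Suc m) < fcfs_departure (arrival_time w m) (D m ?r) (w (Service m (fst ?r)))"
    by (auto simp: fcfs_departure_def arrival_time_eq_epoch)
  have sub: "{s \<in> F. \<forall>d\<in>set (D (Suc m) s). d < epoch w (Suc m)} \<subseteq> ?A - {?r}"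
  proof (intro subsetI)
    fix s assume s: "s \<in> {s \<in> F. \<forall>d\<in>set (D (Suc m) s). d < epoch w (Suc m)}"
    have "s \<noteq> ?r" using s late new by force
    moreover from this have "D (Suc m) s = D m s" by (simp only: departures_Suc_eq if_False)
    ultimately show "s \<in> ?A - {?r}" using s by auto
  qed
  \<comment> \<open>Some fast server is idle, so the job goes to an idle fast server.\<close>
  have "?r \<in> ?A" if "?A \<noteq> {}"
  proof -
    from that obtain s where s: "s \<in> F" "\<forall>d\<in>set (D m s). d < epoch w (Suc m)" by auto
    let ?x = "\<lambda>s. length (filter (\<lambda>d. arrival_time w m \<le> d) (D m s))"
    have "?x s = 0" using s by (auto simp: filter_empty_conv arrival_time_eq_epoch)
    from sa_jsq_prefers_idle_fast[where \<mu> = \<mu> and M = M and x = ?x and u = "w (Tie m)", OF speeds s(1) this]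
    show ?thesis
      by (auto simp: assigned_def[symmetric] filter_empty_conv arrival_time_eq_epoch[symmetric] not_le)
  qed
  then have "card (?A - {?r}) = card ?A - 1"
    using card_Diff_singleton[of ?r ?A] by (cases "?A = {}") (simp_all only: card.empty empty_Diff diff_0_eq_0 not_False_eq_True simp_thms)
  then have le: "card {s \<in> F. \<forall>d\<in>set (D (Suc m) s). d < epoch w (Suc m)} \<le> idle_before m - 1"
    unfolding idle_before_def using card_mono[OF _ sub] by simp
  have "{s \<in> F. \<forall>d\<in>set (D (Suc m) s). d < epoch w (Suc (Suc m))} \<subseteq>
     {s \<in> F. \<forall>d\<in>set (D (Suc m) s). d < epoch w (Suc m)} \<union> {s \<in> F. \<exists>d\<in>set (D (Suc m) s). ?Q d}"
    by (auto simp del: departures.simps simp: not_less)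
  then have "idle_before (Suc m) \<le> card ({s \<in> F. \<forall>d\<in>set (D (Suc m) s). d < epoch w (Suc m)} \<union>
      {s \<in> F. \<exists>d\<in>set (D (Suc m) s). ?Q d})"
    unfolding idle_before_def by (intro card_mono) auto
  also have "\<dots> \<le> card {s \<in> F. \<forall>d\<in>set (D (Suc m) s). d < epoch w (Suc m)} +
      card {s \<in> F. \<exists>d\<in>set (D (Suc m) s). ?Q d}"
    by (rule card_Un_le)
  finally show ?thesis
    using le card_servers_le_num_departures[where Q = ?Q and k = "Suc m" and M = M and N = N and \<mu> = \<mu> and ?x0.0 = x0 and w = w]
    by linarith
qed

text \<open>
  Unrolling the recursion back to the last arrival that found no idle fast server, or to the initial
  state (\<open>j = 0\<close>) if every arrival found one.
\<close>

lemma lindley_bound: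
  assumes "m \<le> K"
  shows "\<exists>j\<le>m. idle_before m + (m - j) \<le> (if j = 0 then card {s \<in> F. x0 s = 0} else 0)
     + num_departures M \<mu> N x0 w K (\<lambda>d. epoch w j \<le> d \<and> d < epoch w (Suc m))"
  using assms
proof (induction m)
  case 0
  have "idle_before 0 \<le> card {s \<in> F. x0 s = 0} + num_departures M \<mu> N x0 w K (\<lambda>d. epoch w 0 \<le> d \<and> d < epoch w (Suc 0))"
    using idle_before_0_le num_departures_mono[of 0 K M \<mu> N x0 w "\<lambda>d. epoch w 0 \<le> d \<and> d < epoch w 1"]
    by simp
  then show ?case by (intro exI[of _ 0]) simp
next
  case (Suc m)
  let ?n = "\<lambda>i k. num_departures M \<mu> N x0 w K (\<lambda>d. epoch w i \<le> d \<and> d < epoch w k)"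
  have step: "idle_before (Suc m) \<le> (idle_before m - 1) + ?n (Suc m) (Suc (Suc m))"
    using idle_before_Suc_le[of m] num_departures_mono[OF Suc.prems] order_trans add_left_mono by meson
  show ?case
  proof (cases "idle_before m = 0")
    case True
    then show ?thesis using step by (intro exI[of _ "Suc m"]) simp
  next
    case False
    obtain j where j: "j \<le> m" "idle_before m + (m - j) \<le> (if j = 0 then card {s \<in> F. x0 s = 0} else 0) + ?n j (Suc m)"
      using Suc by (meson Suc_leD)
    have "?n j (Suc m) + ?n (Suc m) (Suc (Suc m)) = ?n j (Suc (Suc m))"
      using j by (intro num_departures_add) (auto simp: epoch_le_iff)
    then show ?thesis using False j step by (intro exI[of _ j]) auto
  qed
qed

lemma idle_fast_le_idle_before:
  assumes "epoch w m \<le> t" "t < epoch w (Suc m)"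
  shows "idle_fast M \<mu> N x0 w t \<le> idle_before m"
  unfolding idle_fast_def idle_before_def queue_length_def num_arrivals_eq[OF assms]
  using assms by (intro card_mono) (auto simp: filter_empty_conv not_less)

text \<open>
  Between two arrivals the number of idle fast servers can only grow, so the bound at the end of the
  interarrival interval holds for all times in it.
\<close>

lemma idle_fast_bound:
  assumes "0 \<le> t" "t < epoch w K"
  shows "\<exists>m<K. \<exists>j\<le>m. epoch w m \<le> t \<and> t < epoch w (Suc m) \<and>
    idle_fast M \<mu> N x0 w t + (m - j) \<le> (if j = 0 then card {s \<in> F. x0 s = 0} else 0)
     + num_departures M \<mu> N x0 w K (\<lambda>d. epoch w j \<le> d \<and> d \<le> epoch w (Suc m))"
proof -
  obtain m where m: "m < K" "epoch w m \<le> t" "t < epoch w (Suc m)"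
    using epoch_bracket[OF assms] by auto
  obtain j where j: "j \<le> m" "idle_before m + (m - j) \<le> (if j = 0 then card {s \<in> F. x0 s = 0} else 0)
     + num_departures M \<mu> N x0 w K (\<lambda>d. epoch w j \<le> d \<and> d < epoch w (Suc m))"
    using lindley_bound[of m K] m by auto
  have "length (filter (\<lambda>d. u \<le> d \<and> d < v) ds) \<le> length (filter (\<lambda>d. u \<le> d \<and> d \<le> v) ds)" for u v :: real and ds
    by (induction ds) auto
  then have "num_departures M \<mu> N x0 w K (\<lambda>d. epoch w j \<le> d \<and> d < epoch w (Suc m))
    \<le> num_departures M \<mu> N x0 w K (\<lambda>d. epoch w j \<le> d \<and> d \<le> epoch w (Suc m))"
    unfolding num_departures_def by (intro sum_mono)
  then show ?thesis using m j idle_fast_le_idle_before[OF m(2,3)]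
    by (intro exI[of _ m] conjI exI[of _ j]) auto
qed

end

section \<open>Measurability of sample paths\<close>

text \<open>
  In place of a \<open>\<sigma>\<close>-algebra on lists: a random list is described by its length and its entries, which
  are set to \<open>0\<close> beyond the end.
\<close>

definition list_measurable :: "'x measure \<Rightarrow> ('x \<Rightarrow> real list) \<Rightarrow> bool" where
  "list_measurable K f \<longleftrightarrow> (\<lambda>x. length (f x)) \<in> K \<rightarrow>\<^sub>M count_space UNIV \<and>
     (\<forall>i. (\<lambda>x. if i < length (f x) then f x ! i else 0) \<in> borel_measurable K)"

lemma list_measurableD:
  assumes "list_measurable K f"
  shows "(\<lambda>x. length (f x)) \<in> K \<rightarrow>\<^sub>M count_space UNIV"
    "(\<lambda>x. if i < length (f x) then f x ! i else 0) \<in> borel_measurable K"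
  using assms by (auto simp: list_measurable_def)

lemma list_measurable_map_upt:
  assumes [measurable]: "\<And>i. (\<lambda>x. g x i) \<in> borel_measurable K"
  shows "list_measurable K (\<lambda>x. map (g x) [0..<n])"
  unfolding list_measurable_def by (auto cong: if_cong)

lemma list_measurable_snoc:
  assumes f: "list_measurable K f" and [measurable]: "g \<in> borel_measurable K"
  shows "list_measurable K (\<lambda>x. f x @ [g x])"
proof -
  note [measurable] = list_measurableD[OF f]
  have "(if i < length (f x @ [g x]) then (f x @ [g x]) ! i else 0)
     = (if i = length (f x) then g x else if i < length (f x) then f x ! i else 0)" for i x
    by (auto simp: nth_append)
  then show ?thesis
    unfolding list_measurable_def by simp
qed

lemma list_measurable_if:
  assumes f: "list_measurable K f" and g: "list_measurable K g" and [measurable]: "Measurable.pred K Q"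
  shows "list_measurable K (\<lambda>x. if Q x then f x else g x)"
proof -
  note [measurable] = list_measurableD[OF f] list_measurableD[OF g]
  have 1: "length (if Q x then f x else g x) = (if Q x then length (f x) else length (g x))" for x
    by simp
  have 2: "(if i < (if Q x then length (f x) else length (g x)) then (if Q x then f x else g x) ! i else 0)
     = (if Q x then if i < length (f x) then f x ! i else 0 else if i < length (g x) then g x ! i else 0)" for i x
    by simp
  show ?thesis
    unfolding list_measurable_def 1 2 by measurable
qed

lemma list_measurable_last:
  assumes f: "list_measurable K f"
  shows "(\<lambda>x. if f x = [] then 0 else last (f x)) \<in> borel_measurable K"
proof -
  note [measurable] = list_measurableD[OF f]
  have "(\<lambda>x. (\<lambda>n x. if n < length (f x) then f x ! n else 0) (length (f x) - 1) x) \<in> borel_measurable K"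
    by (rule measurable_compose_countable) measurable
  then show ?thesis
    by (rule measurable_cong[THEN iffD1, rotated]) (auto simp: last_conv_nth)
qed

lemma list_measurable_filter:
  assumes f: "list_measurable K f"
    and Q: "Measurable.pred (K \<Otimes>\<^sub>M borel) (\<lambda>p. Q (fst p) (snd p))"
  shows "(\<lambda>x. length (filter (Q x) (f x))) \<in> K \<rightarrow>\<^sub>M count_space UNIV"
proof -
  note [measurable] = list_measurableD[OF f]
  have "Measurable.pred K (\<lambda>x. i < length (f x) \<and> Q x (f x ! i))" for i
  proof -
    have [measurable]: "Measurable.pred K (\<lambda>x. Q x (if i < length (f x) then f x ! i else 0))"
      using measurable_compose[OF _ Q, of "\<lambda>x. (x, if i < length (f x) then f x ! i else 0)" K]
      by simp
    have "Measurable.pred K (\<lambda>x. i < length (f x) \<and> Q x (if i < length (f x) then f x ! i else 0))"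
      by measurable
    then show ?thesis by (rule measurable_cong[THEN iffD1, rotated]) auto
  qed
  then show ?thesis
    unfolding length_filter_conv_card by (intro measurable_card) (simp add: pred_def)
qed

abbreviation input_space :: "(input \<Rightarrow> real) measure" where
  "input_space \<equiv> PiM UNIV (\<lambda>_. borel)"

lemma sa_jsq_restrict: "sa_jsq \<mu> S (restrict x S) u = sa_jsq \<mu> S x u"
proof -
  have "shortest S (restrict x S) = shortest S x"
    by (auto simp: shortest_def)
  then show ?thesis by (simp add: sa_jsq_def fastest_shortest_def)
qed

text \<open>
  The decision depends on the queue lengths at finitely many servers, hence on countably many
  states, and for a fixed state it is a function of the tie-breaking variable alone.
\<close>

lemma measurable_sa_jsq:
  assumes "finite S" and q: "\<And>s. s \<in> S \<Longrightarrow> (\<lambda>w. q w s) \<in> K \<rightarrow>\<^sub>M count_space UNIV"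
    and [measurable]: "U \<in> borel_measurable K"
  shows "(\<lambda>w. sa_jsq \<mu> S (q w) (U w)) \<in> K \<rightarrow>\<^sub>M count_space UNIV"
proof -
  have "(\<lambda>w. sa_jsq \<mu> S (restrict (q w) S) (U w)) \<in> K \<rightarrow>\<^sub>M count_space UNIV"
  proof (rule measurable_compose_countable'[where I = "PiE S (\<lambda>_. UNIV)" and f = "\<lambda>x w. sa_jsq \<mu> S x (U w)"])
    show "(\<lambda>w. restrict (q w) S) \<in> K \<rightarrow>\<^sub>M count_space (PiE S (\<lambda>_. UNIV))"
    proof -
      have "PiM S (\<lambda>_. count_space (UNIV :: nat set)) = count_space (PiE S (\<lambda>_. UNIV))"
        using \<open>finite S\<close> by (rule count_space_PiM_finite) auto
      moreover have "(\<lambda>w. restrict (q w) S) \<in> K \<rightarrow>\<^sub>M PiM S (\<lambda>_. count_space UNIV)"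
        by (rule measurable_restrict) (rule q)
      ultimately show ?thesis by simp
    qed
    show "countable (PiE S (\<lambda>_. UNIV :: nat set))"
      using \<open>finite S\<close> by (intro countable_PiE) auto
    fix x :: "server \<Rightarrow> nat"
    show "(\<lambda>w. sa_jsq \<mu> S x (U w)) \<in> K \<rightarrow>\<^sub>M count_space UNIV"
      unfolding sa_jsq_def Let_def by measurable
  qed
  then show ?thesis by (simp add: sa_jsq_restrict)
qed

lemma measurable_arrival_time [measurable]: "(\<lambda>w. arrival_time w k) \<in> borel_measurable input_space"
  unfolding arrival_time_def by measurable

lemma measurable_epoch [measurable]: "(\<lambda>w. epoch w k) \<in> borel_measurable input_space"
  unfolding epoch_def by measurable

lemma measurable_assigned_aux:
  assumes "finite S" "\<And>s. s \<in> S \<Longrightarrow> list_measurable input_space (\<lambda>w. departures \<mu> S x0 w k s)"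
  shows "(\<lambda>w. assigned \<mu> S x0 w k) \<in> input_space \<rightarrow>\<^sub>M count_space UNIV"
  unfolding assigned_def
proof (rule measurable_sa_jsq[OF assms(1)])
  fix s assume "s \<in> S"
  show "(\<lambda>w. length (filter (\<lambda>d. arrival_time w k \<le> d) (departures \<mu> S x0 w k s)))
      \<in> input_space \<rightarrow>\<^sub>M count_space UNIV"
    by (rule list_measurable_filter[OF assms(2)[OF \<open>s \<in> S\<close>]]) measurable
qed measurable

lemma list_measurable_departures:
  assumes "finite S" "s \<in> S"
  shows "list_measurable input_space (\<lambda>w. departures \<mu> S x0 w k s)"
  using assms(2)
proof (induction k arbitrary: s)
  case 0
  show ?case unfolding departures.simps by (rule list_measurable_map_upt) measurable
next
  case (Suc k)
  have [measurable]: "(\<lambda>w. assigned \<mu> S x0 w k) \<in> input_space \<rightarrow>\<^sub>M count_space UNIV"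
    using assms(1) Suc.IH by (rule measurable_assigned_aux)
  note D = Suc.IH[OF Suc.prems]
  note [measurable] = list_measurable_last[OF D] list_measurableD(1)[OF D]
  have "fcfs_departure (arrival_time w k) (departures \<mu> S x0 w k s) v =
     (if length (departures \<mu> S x0 w k s) = 0 then arrival_time w k
      else max (arrival_time w k) (if departures \<mu> S x0 w k s = [] then 0 else last (departures \<mu> S x0 w k s))) + v" for w v
    by (simp add: fcfs_departure_def)
  then have [measurable]: "(\<lambda>w. fcfs_departure (arrival_time w k) (departures \<mu> S x0 w k s) (w (Service k (fst s))))
     \<in> borel_measurable input_space"
    by (simp only:) measurable
  show ?case
    unfolding departures_Suc_eq
    by (intro list_measurable_if list_measurable_snoc D) measurable
qed

lemma measurable_assigned:
  assumes "finite S"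
  shows "(\<lambda>w. assigned \<mu> S x0 w k) \<in> input_space \<rightarrow>\<^sub>M count_space UNIV"
  by (rule measurable_assigned_aux[OF assms list_measurable_departures[OF assms]])

lemma measurable_num_departures:
  assumes [measurable]: "u \<in> borel_measurable input_space" "t \<in> borel_measurable input_space"
  shows "(\<lambda>w. num_departures M \<mu> N x0 w k (\<lambda>d. u w \<le> d \<and> d \<le> t w)) \<in> input_space \<rightarrow>\<^sub>M count_space UNIV"
proof -
  have [measurable]: "(\<lambda>w. length (filter (\<lambda>d. u w \<le> d \<and> d \<le> t w) (departures \<mu> (servers M N) x0 w k s)))
     \<in> input_space \<rightarrow>\<^sub>M count_space UNIV" if "s \<in> servers (M - 1) N" for s
    using that servers_mono[of "M - 1" M N]
    by (intro list_measurable_filter list_measurable_departures) (auto, measurable)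
  show ?thesis unfolding num_departures_def by (rule measurable_sum_nat) measurable
qed

lemma measurable_queue_length:
  assumes "finite S" "s \<in> S"
  shows "(\<lambda>w. queue_length \<mu> S x0 w t s) \<in> input_space \<rightarrow>\<^sub>M count_space UNIV"
proof -
  have [measurable]: "(\<lambda>w. num_arrivals w t) \<in> input_space \<rightarrow>\<^sub>M count_space UNIV"
    unfolding num_arrivals_def by measurable
  have "(\<lambda>w. length (filter (\<lambda>d. t < d) (departures \<mu> S x0 w k s))) \<in> input_space \<rightarrow>\<^sub>M count_space UNIV" for k
    using assms by (intro list_measurable_filter list_measurable_departures) measurable
  then show ?thesis
    unfolding queue_length_def by (rule measurable_compose_countable) measurable
qed

lemma measurable_idle_fast:
  "(\<lambda>w. idle_fast M \<mu> N x0 w t) \<in> input_space \<rightarrow>\<^sub>M count_space UNIV"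
proof -
  have "idle_fast M \<mu> N x0 w t = (\<Sum>s\<in>servers (M - 1) N. if queue_length \<mu> (servers M N) x0 w t s = 0 then 1 else 0)" for w
    by (simp add: idle_fast_def sum.If_cases Int_def)
  moreover have [measurable]: "(\<lambda>w. queue_length \<mu> (servers M N) x0 w t s) \<in> input_space \<rightarrow>\<^sub>M count_space UNIV"
    if "s \<in> servers (M - 1) N" for s
    using that servers_mono[of "M - 1" M N] by (intro measurable_queue_length) auto
  ultimately show ?thesis by (simp only:) (rule measurable_sum_nat, measurable)
qed

section \<open>Exponential weights of departures\<close>

text \<open>
  The projection to \<open>[u, t]\<close> if \<open>u \<le> t\<close>. For \<open>x \<le> y\<close>, the difference \<open>clip u t y - clip u t x\<close> is the length of
  \<open>[x, y]\<close> within \<open>[u, t]\<close>; in this form lengths of adjacent intervals telescope.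
\<close>

definition clip :: "real \<Rightarrow> real \<Rightarrow> real \<Rightarrow> real" where
  "clip u t y = min (max y u) t"

definition job_weight :: "real \<Rightarrow> real \<Rightarrow> real \<Rightarrow> real \<Rightarrow> real \<Rightarrow> real \<Rightarrow> real" where
  "job_weight z m u t \<sigma> v =
     (if u \<le> \<sigma> + v \<and> \<sigma> + v \<le> t then z else 1) *
     exp (- ((z - 1) * m * (clip u t (\<sigma> + v) - clip u t \<sigma>)))"

lemma job_weight_nonneg: "z \<ge> 1 \<Longrightarrow> 0 \<le> job_weight z m u t \<sigma> v"
  by (auto simp: job_weight_def)

lemma measurable_clip [measurable]:
  assumes [measurable]: "u \<in> borel_measurable K" "t \<in> borel_measurable K" "y \<in> borel_measurable K"
  shows "(\<lambda>x. clip (u x) (t x) (y x)) \<in> borel_measurable K"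
  unfolding clip_def by measurable

lemma measurable_job_weight [measurable]: "job_weight z m u t \<sigma> \<in> borel_measurable borel"
  unfolding job_weight_def by measurable

text \<open>
  The compensation of a single job. Multiplied by the density \<open>m exp (- m v)\<close>, the weight has the
  continuous antiderivative \<open>- exp (- m v - (z - 1) m (clip u t (\<sigma> + v) - clip u t \<sigma>))\<close>: outside
  \<open>[u, t]\<close> the exponent decreases at rate \<open>m\<close>, and inside at rate \<open>z m\<close>, where the weight carries the
  factor \<open>z\<close>. The antiderivative increases from \<open>-1\<close> to \<open>0\<close>. This holds for every start \<open>\<sigma>\<close>, before
  or after \<open>u\<close>; here the memoryless property enters.
\<close>

lemma nn_integral_job_weight_le_1:
  assumes m: "m > 0" and z: "z \<ge> 1"
  shows "(\<integral>\<^sup>+v. ennreal (job_weight z m u t \<sigma> v) \<partial>density lborel (exponential_density m)) \<le> 1"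
proof (cases "u \<le> t")
  case False
  then have "job_weight z m u t \<sigma> v = 1" for v
    by (auto simp: job_weight_def clip_def)
  moreover have "prob_space (density lborel (exponential_density m))"
    using m by (rule prob_space_exponential_density)
  ultimately show ?thesis
    using prob_space.emeasure_space_1 by fastforce
next
  case True
  \<comment> \<open>The service time \<open>v\<close> runs through three phases: before \<open>[u, t]\<close>, up to \<open>v = p\<close>; inside, up to
      \<open>v = q\<close>; and after it.\<close>
  define p where "p = max (u - \<sigma>) 0"
  define q where "q = max (t - \<sigma>) 0"
  have pq: "0 \<le> p" "p \<le> q" using True by (auto simp: p_def q_def)
  define f1 where "f1 v = m * exp (- m * v)" for v
  define f2 where "f2 v = z * m * exp (- m * v - (z - 1) * m * (v - p))" for v
  define f3 where "f3 v = m * exp (- m * v - (z - 1) * m * (q - p))" for v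
  have [measurable]: "f1 \<in> borel_measurable borel" "f2 \<in> borel_measurable borel" "f3 \<in> borel_measurable borel"
    unfolding f1_def f2_def f3_def by measurable
  have nn: "0 \<le> f1 v" "0 \<le> f2 v" "0 \<le> f3 v" for v
    using m z by (auto simp: f1_def f2_def f3_def)
  have pw: "ennreal (exponential_density m v) * ennreal (job_weight z m u t \<sigma> v)
      \<le> ennreal (f1 v) * indicator {0..p} v + ennreal (f2 v) * indicator {p..q} v
        + ennreal (f3 v) * indicator {q..} v" for v
  proof -
    consider "v < 0" | "0 \<le> v" "v < p" | "p \<le> v" "v \<le> q" | "v > q" "v \<ge> 0"
      using pq by linarith
    then show ?thesis
    proof cases
      case 1 then show ?thesis by (simp add: erlang_density_def)
    next
      case 2
      then have "job_weight z m u t \<sigma> v = 1"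
        using True by (auto simp: job_weight_def clip_def p_def)
      then show ?thesis using 2 pq m by (simp add: erlang_density_def f1_def)
    next
      case 3
      have "job_weight z m u t \<sigma> v \<le> z * exp (- ((z - 1) * m * (v - p)))"
      proof (cases "\<sigma> < t")
        case True
        then have "clip u t (\<sigma> + v) - clip u t \<sigma> = v - p"
          using 3 by (auto simp: clip_def p_def q_def)
        then show ?thesis using z by (auto simp: job_weight_def)
      next
        case False
        then have "v = 0" "p = 0" using 3 \<open>u \<le> t\<close> by (auto simp: p_def q_def)
        then show ?thesis using z by (auto simp: job_weight_def)
      qed
      then have "m * exp (- m * v) * job_weight z m u t \<sigma> v
          \<le> m * exp (- m * v) * (z * exp (- ((z - 1) * m * (v - p))))"
        using m by (intro mult_left_mono) auto
      also have "\<dots> = f2 v" unfolding f2_def by (simp add: exp_diff exp_minus exp_add field_simps)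
      finally have "ennreal (exponential_density m v) * ennreal (job_weight z m u t \<sigma> v) \<le> ennreal (f2 v)"
        using 3 pq m z by (simp add: erlang_density_def ennreal_mult[symmetric] job_weight_nonneg ennreal_leI)
      also have "\<dots> \<le> ennreal (f1 v) * indicator {0..p} v + ennreal (f2 v) * indicator {p..q} v
        + ennreal (f3 v) * indicator {q..} v"
        using 3 by (simp add: add_increasing add_increasing2)
      finally show ?thesis .
    next
      case 4
      have "job_weight z m u t \<sigma> v = exp (- ((z - 1) * m * (q - p)))"
        using 4 True by (auto simp: job_weight_def clip_def p_def q_def max_def min_def split: if_splits)
      then have "m * exp (- m * v) * job_weight z m u t \<sigma> v = f3 v"
        by (simp add: f3_def exp_diff exp_minus exp_add field_simps)
      then have "ennreal (exponential_density m v) * ennreal (job_weight z m u t \<sigma> v) = ennreal (f3 v)"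
        using 4 pq m z by (simp add: erlang_density_def ennreal_mult[symmetric] job_weight_nonneg)
      then show ?thesis
        using 4 by (simp add: add_increasing add_increasing2)
    qed
  qed
  have I1: "(\<integral>\<^sup>+v. ennreal (f1 v) * indicator {0..p} v \<partial>lborel) = ennreal (- exp (- m * p) - - exp (- m * 0))"
    using pq nn by (intro nn_integral_FTC_Icc)
      (auto intro!: derivative_eq_intros simp: f1_def has_real_derivative_iff_has_vector_derivative[symmetric])
  have I2: "(\<integral>\<^sup>+v. ennreal (f2 v) * indicator {p..q} v \<partial>lborel)
     = ennreal (- exp (- m * q - (z - 1) * m * (q - p)) - - exp (- m * p - (z - 1) * m * (p - p)))"
    using pq nn by (intro nn_integral_FTC_Icc)
      (auto intro!: derivative_eq_intros simp: f2_def algebra_simps has_real_derivative_iff_has_vector_derivative[symmetric])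
  have I3: "(\<integral>\<^sup>+v. ennreal (f3 v) * indicator {q..} v \<partial>lborel)
     = ennreal (0 - - exp (- m * q - (z - 1) * m * (q - p)))"
  proof (rule nn_integral_FTC_atLeast[where F = "\<lambda>v. - exp (- m * v - (z - 1) * m * (q - p))"])
    show "((\<lambda>v. - exp (- m * v - (z - 1) * m * (q - p))) \<longlongrightarrow> 0) at_top"
      using m by real_asymp
  qed (use m nn in \<open>auto intro!: derivative_eq_intros simp: f3_def\<close>)
  have "(\<integral>\<^sup>+v. ennreal (job_weight z m u t \<sigma> v) \<partial>density lborel (exponential_density m))
      = (\<integral>\<^sup>+v. ennreal (exponential_density m v) * ennreal (job_weight z m u t \<sigma> v) \<partial>lborel)"
    by (subst nn_integral_density) auto
  also have "\<dots> \<le> (\<integral>\<^sup>+v. ennreal (f1 v) * indicator {0..p} v + ennreal (f2 v) * indicator {p..q} v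
        + ennreal (f3 v) * indicator {q..} v \<partial>lborel)"
    by (intro nn_integral_mono pw)
  also have "\<dots> = (\<integral>\<^sup>+v. ennreal (f1 v) * indicator {0..p} v \<partial>lborel)
     + (\<integral>\<^sup>+v. ennreal (f2 v) * indicator {p..q} v \<partial>lborel)
     + (\<integral>\<^sup>+v. ennreal (f3 v) * indicator {q..} v \<partial>lborel)"
    by (simp add: nn_integral_add)
  also have "\<dots> = ennreal 1"
  proof -
    have *: "exp (- m * q - (z - 1) * m * (q - p)) \<le> exp (- m * p)"
    proof -
      have "m * p \<le> m * q" "0 \<le> (z - 1) * m * (q - p)" using pq m z by auto
      then show ?thesis unfolding exp_le_cancel_iff by linarith
    qed
    have "exp (- m * p) \<le> 1" using pq m by simp
    with * show ?thesis
      unfolding I1 I2 I3 by (simp flip: ennreal_plus)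
  qed
  finally show ?thesis by simp
qed

text \<open>
  An upper bound on the time within \<open>[u, t]\<close> that a server with departure times \<open>ds\<close> spends serving:
  idle times before the last departure are included, so that the bound depends on the last departure
  only.
\<close>

definition busy_bound :: "real \<Rightarrow> real \<Rightarrow> real list \<Rightarrow> real" where
  "busy_bound u t ds = (if ds = [] then 0 else clip u t (last ds) - min u t)"

text \<open>
  The product of the weights of all jobs of one server, except that idle times also count as busy,
  which only lowers the weight.
\<close>

definition queue_weight :: "real \<Rightarrow> real \<Rightarrow> real \<Rightarrow> real \<Rightarrow> real list \<Rightarrow> real" where
  "queue_weight z m u t ds =
     z ^ length (filter (\<lambda>d. u \<le> d \<and> d \<le> t) ds) * exp (- ((z - 1) * m * busy_bound u t ds))"

lemma queue_weight_Nil [simp]: "queue_weight z m u t [] = 1"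
  by (simp add: queue_weight_def busy_bound_def)

lemma queue_weight_nonneg: "z \<ge> 1 \<Longrightarrow> 0 \<le> queue_weight z m u t ds"
  by (simp add: queue_weight_def)

text \<open>
  The new job starts at \<open>\<sigma>\<close>, not before the previous departure, so its service time within \<open>[u, t]\<close>
  is at most the increase of the busy bound.
\<close>

lemma queue_weight_snoc_le:
  assumes z: "z \<ge> 1" and m: "m \<ge> 0" and \<sigma>: "ds \<noteq> [] \<Longrightarrow> last ds \<le> \<sigma>"
  shows "queue_weight z m u t (ds @ [\<sigma> + v]) \<le> queue_weight z m u t ds * job_weight z m u t \<sigma> v"
proof -
  let ?b = "busy_bound u t" and ?n = "length (filter (\<lambda>d. u \<le> d \<and> d \<le> t) ds)"
  let ?f = "if u \<le> \<sigma> + v \<and> \<sigma> + v \<le> t then z else 1"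
  have "?b ds + (clip u t (\<sigma> + v) - clip u t \<sigma>) \<le> ?b (ds @ [\<sigma> + v])"
    using \<sigma> by (auto simp: busy_bound_def clip_def)
  then have "(z - 1) * m * (?b ds + (clip u t (\<sigma> + v) - clip u t \<sigma>)) \<le> (z - 1) * m * ?b (ds @ [\<sigma> + v])"
    using z m by (intro mult_left_mono) auto
  then have "exp (- ((z - 1) * m * ?b (ds @ [\<sigma> + v])))
      \<le> exp (- ((z - 1) * m * ?b ds) + - ((z - 1) * m * (clip u t (\<sigma> + v) - clip u t \<sigma>)))"
    unfolding exp_le_cancel_iff by (simp add: algebra_simps)
  then have "(z ^ ?n * ?f) * exp (- ((z - 1) * m * ?b (ds @ [\<sigma> + v])))
      \<le> (z ^ ?n * ?f) * (exp (- ((z - 1) * m * ?b ds)) * exp (- ((z - 1) * m * (clip u t (\<sigma> + v) - clip u t \<sigma>))))"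
    using z unfolding exp_add by (intro mult_left_mono) auto
  moreover have "z ^ length (filter (\<lambda>d. u \<le> d \<and> d \<le> t) (ds @ [\<sigma> + v])) = z ^ ?n * ?f"
    by simp
  ultimately show ?thesis
    unfolding queue_weight_def job_weight_def by (simp add: mult_ac)
qed

lemma measurable_queue_weight:
  assumes f: "list_measurable K f" and [measurable]: "u \<in> borel_measurable K" "t \<in> borel_measurable K"
  shows "(\<lambda>x. queue_weight z m (u x) (t x) (f x)) \<in> borel_measurable K"
proof -
  note [measurable] = list_measurable_last[OF f] list_measurableD(1)[OF f]
  have [measurable]: "(\<lambda>x. length (filter (\<lambda>d. u x \<le> d \<and> d \<le> t x) (f x))) \<in> K \<rightarrow>\<^sub>M count_space UNIV"
    by (intro list_measurable_filter f) measurable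
  have "busy_bound (u x) (t x) (f x) = (if length (f x) = 0 then 0 else
     clip (u x) (t x) (if f x = [] then 0 else last (f x)) - min (u x) (t x))" for x
    by (simp add: busy_bound_def)
  then show ?thesis unfolding queue_weight_def by (simp only:) measurable
qed

definition fast_weight ::
  "nat \<Rightarrow> (nat \<Rightarrow> real) \<Rightarrow> (nat \<Rightarrow> nat) \<Rightarrow> real \<Rightarrow> real \<Rightarrow> real \<Rightarrow> (server \<Rightarrow> real list) \<Rightarrow> real" where
  "fast_weight M \<mu> N z u t D = (\<Prod>s\<in>servers (M - 1) N. queue_weight z (\<mu> (fst s)) u t (D s))"

lemma fast_weight_nonneg: "z \<ge> 1 \<Longrightarrow> 0 \<le> fast_weight M \<mu> N z u t D"
  by (simp add: fast_weight_def queue_weight_nonneg prod_nonneg)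

lemma fast_weight_snoc_le:
  assumes z: "z \<ge> 1" and m: "\<mu> (fst r) \<ge> 0" and r: "r \<in> servers (M - 1) N"
    and \<sigma>: "D r \<noteq> [] \<Longrightarrow> last (D r) \<le> \<sigma>"
  shows "fast_weight M \<mu> N z u t (D(r := D r @ [\<sigma> + v]))
     \<le> fast_weight M \<mu> N z u t D * job_weight z (\<mu> (fst r)) u t \<sigma> v"
proof -
  let ?F = "servers (M - 1) N"
  let ?c = "\<Prod>s\<in>?F - {r}. queue_weight z (\<mu> (fst s)) u t (D s)"
  have "fast_weight M \<mu> N z u t (D(r := D r @ [\<sigma> + v]))
     = queue_weight z (\<mu> (fst r)) u t (D r @ [\<sigma> + v]) * ?c"
    unfolding fast_weight_def using r by (subst prod.remove[of _ r]) auto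
  also have "\<dots> \<le> queue_weight z (\<mu> (fst r)) u t (D r) * job_weight z (\<mu> (fst r)) u t \<sigma> v * ?c"
    by (intro mult_right_mono queue_weight_snoc_le z m \<sigma> prod_nonneg queue_weight_nonneg)
  also have "\<dots> = fast_weight M \<mu> N z u t D * job_weight z (\<mu> (fst r)) u t \<sigma> v"
    unfolding fast_weight_def using r by (subst prod.remove[of _ r]) auto
  finally show ?thesis .
qed

lemma fast_weight_cong:
  "(\<And>s. s \<in> servers (M - 1) N \<Longrightarrow> D s = D' s) \<Longrightarrow> fast_weight M \<mu> N z u t D = fast_weight M \<mu> N z u t D'"
  by (simp add: fast_weight_def)

text \<open>
  A server works for a time of at most \<open>t - u\<close> within \<open>[u, t]\<close>, so the negative exponents in the weights
  cost at most the factor on the right.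
\<close>

lemma power_num_departures_le:
  assumes z: "z \<ge> 1" and \<mu>: "\<And>s. s \<in> servers (M - 1) N \<Longrightarrow> \<mu> (fst s) \<ge> 0" and ut: "u \<le> t"
  shows "z ^ num_departures M \<mu> N x0 w k (\<lambda>d. u \<le> d \<and> d \<le> t)
    \<le> exp ((z - 1) * (\<Sum>s\<in>servers (M - 1) N. \<mu> (fst s)) * (t - u))
      * fast_weight M \<mu> N z u t (departures \<mu> (servers M N) x0 w k)"
proof -
  let ?F = "servers (M - 1) N" and ?D = "departures \<mu> (servers M N) x0 w k"
  let ?Q = "\<lambda>d. u \<le> d \<and> d \<le> t"
  have "z ^ length (filter ?Q (?D s)) \<le> exp ((z - 1) * \<mu> (fst s) * (t - u)) * queue_weight z (\<mu> (fst s)) u t (?D s)"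
    if s: "s \<in> ?F" for s
  proof -
    have "busy_bound u t (?D s) \<le> t - u" using ut by (auto simp: busy_bound_def clip_def)
    then have "(z - 1) * \<mu> (fst s) * busy_bound u t (?D s) \<le> (z - 1) * \<mu> (fst s) * (t - u)"
      using z \<mu>[OF s] by (intro mult_left_mono) auto
    then have "1 \<le> exp ((z - 1) * \<mu> (fst s) * (t - u) + - ((z - 1) * \<mu> (fst s) * busy_bound u t (?D s)))"
      by simp
    then have "z ^ length (filter ?Q (?D s)) * 1 \<le> z ^ length (filter ?Q (?D s)) *
      (exp ((z - 1) * \<mu> (fst s) * (t - u)) * exp (- ((z - 1) * \<mu> (fst s) * busy_bound u t (?D s))))"
      using z unfolding exp_add by (intro mult_left_mono) auto
    then show ?thesis by (simp add: queue_weight_def mult_ac)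
  qed
  then have "(\<Prod>s\<in>?F. z ^ length (filter ?Q (?D s)))
     \<le> (\<Prod>s\<in>?F. exp ((z - 1) * \<mu> (fst s) * (t - u)) * queue_weight z (\<mu> (fst s)) u t (?D s))"
    using z by (intro prod_mono) auto
  also have "\<dots> = exp ((z - 1) * (\<Sum>s\<in>?F. \<mu> (fst s)) * (t - u)) * fast_weight M \<mu> N z u t ?D"
    by (simp add: prod.distrib fast_weight_def exp_sum sum_distrib_left sum_distrib_right)
  finally show ?thesis by (simp add: num_departures_def power_sum)
qed

section \<open>Integrating out the inputs\<close>

text \<open>
  The service time of job \<open>k'\<close> influences neither its own assignment nor anything about the jobs
  before it. This makes the order of the jobs a substitute for a filtration in time.
\<close>

lemma assigned_upd_Service:
  assumes "k \<le> k'"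
  shows "departures \<mu> S x0 (w(Service k' j := v)) k = departures \<mu> S x0 w k"
    and "assigned \<mu> S x0 (w(Service k' j := v)) k = assigned \<mu> S x0 w k"
proof -
  have arr: "arrival_time (w(Service k' j := v)) i = arrival_time w i" for i
    by (simp add: arrival_time_def)
  show D: "departures \<mu> S x0 (w(Service k' j := v)) k = departures \<mu> S x0 w k"
    using assms by (induction k) (simp_all add: arr Let_def)
  show "assigned \<mu> S x0 (w(Service k' j := v)) k = assigned \<mu> S x0 w k"
    by (simp add: assigned_def D arr)
qed

text \<open>
  Functions of the interarrival times alone. Such functions stay constant while service times are
  integrated out, so the ends of the window \<open>[u, t]\<close> may be arrival times of later jobs.
\<close>

definition gap_determined :: "((input \<Rightarrow> real) \<Rightarrow> 'b) \<Rightarrow> bool" where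
  "gap_determined f \<longleftrightarrow> (\<forall>w i v. (\<forall>k. i \<noteq> Gap k) \<longrightarrow> f (w(i := v)) = f w)"

lemma gap_determinedD:
  assumes "gap_determined f"
  shows "f (w(Service k j := v)) = f w" "f (w(Initial_Service s l := v)) = f w"
  using assms by (auto simp: gap_determined_def)

lemma gap_determined_epoch [simp]: "gap_determined (\<lambda>w. epoch w k)"
  unfolding gap_determined_def epoch_def by (intro allI impI sum.cong) auto

lemma epoch_upd_Gap: "epoch (w(Gap m := v)) j = (if m < j then epoch w j - w (Gap m) + v else epoch w j)"
proof -
  have "epoch (w(Gap m := v)) j = epoch w j" if "j \<le> m"
    unfolding epoch_def using that by (intro sum.cong) auto
  moreover have "epoch (w(Gap m := v)) j = epoch w j - w (Gap m) + v" if "m < j"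
  proof -
    have "epoch (w(Gap m := v)) j = v + (\<Sum>i\<in>{..<j} - {m}. w (Gap i))"
      unfolding epoch_def using that by (subst sum.remove[of _ m]) (auto intro!: sum.cong)
    moreover have "epoch w j = w (Gap m) + (\<Sum>i\<in>{..<j} - {m}. w (Gap i))"
      unfolding epoch_def using that by (subst sum.remove[of _ m]) auto
    ultimately show ?thesis by simp
  qed
  ultimately show ?thesis by simp
qed

lemma nn_integral_exp_exponential:
  assumes "x < a" "0 < a"
  shows "(\<integral>\<^sup>+v. ennreal (exp (x * v)) \<partial>density lborel (exponential_density a)) = ennreal (a / (a - x))"
proof -
  have "ennreal (exponential_density a v) * ennreal (exp (x * v))
      = ennreal (a / (a - x)) * ennreal (exponential_density (a - x) v)" for v
  proof -
    have density: "exponential_density b v = (if v < 0 then 0 else b * exp (- b * v))" for b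
      by (simp add: erlang_density_def)
    have "exp (- a * v) * exp (x * v) = exp (- (a - x) * v)"
      by (simp add: algebra_simps flip: exp_add)
    then have "a * exp (- a * v) * exp (x * v) = a / (a - x) * ((a - x) * exp (- (a - x) * v))"
      using assms by (simp only: mult.assoc) simp
    then have "exponential_density a v * exp (x * v) = a / (a - x) * exponential_density (a - x) v"
      unfolding density by (simp only: if_distrib[of "\<lambda>y. y * _"] if_distrib[of "\<lambda>y. _ * y"] mult_zero_left mult_zero_right)
    then show ?thesis
      using assms by (simp only: ennreal_mult'[symmetric] erlang_density_nonneg exp_ge_zero divide_nonneg_nonneg
          less_imp_le diff_gt_0_iff_gt ennreal_mult''[symmetric])
  qed
  then have "(\<integral>\<^sup>+v. ennreal (exp (x * v)) \<partial>density lborel (exponential_density a))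
      = (\<integral>\<^sup>+v. ennreal (a / (a - x)) * ennreal (exponential_density (a - x) v) \<partial>lborel)"
    by (subst nn_integral_density) auto
  also have "\<dots> = ennreal (a / (a - x)) * emeasure (density lborel (exponential_density (a - x))) UNIV"
    by (subst nn_integral_cmult) (auto simp: emeasure_density)
  also have "emeasure (density lborel (exponential_density (a - x))) UNIV = 1"
    using prob_space.emeasure_space_1[OF prob_space_exponential_density[of "a - x"]] assms by simp
  finally show ?thesis by simp
qed

lemma AE_exponential_pos: "AE v in density lborel (exponential_density a). 0 < v"
proof -
  have "AE v in lborel. v \<noteq> (0::real)" by (rule AE_lborel_singleton)
  then show ?thesis
    by (subst AE_density) (auto simp: erlang_density_def elim!: eventually_mono)
qed

locale input_law =
  fixes M :: nat and \<mu> :: "nat \<Rightarrow> real" and N :: "nat \<Rightarrow> nat" and a :: real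
    and \<nu> :: "input \<Rightarrow> real measure"
  assumes prob_\<nu>: "\<And>i. prob_space (\<nu> i)"
    and sets_\<nu> [measurable_cong, simp]: "\<And>i. sets (\<nu> i) = sets borel"
    and gap: "\<And>k. \<nu> (Gap k) = density lborel (exponential_density a)"
    and service: "\<And>k j. j \<in> {1..M} \<Longrightarrow> \<nu> (Service k j) = density lborel (exponential_density (\<mu> j))"
    and initial: "\<And>s l. s \<in> servers M N \<Longrightarrow>
        \<nu> (Initial_Service s l) = density lborel (exponential_density (\<mu> (fst s)))"
    and rate_pos: "0 < a"
    and speed_pos: "\<And>j. j \<in> {1..M} \<Longrightarrow> 0 < \<mu> j"
    and speeds: "\<And>i j. 1 \<le> i \<Longrightarrow> i < j \<Longrightarrow> j \<le> M \<Longrightarrow> \<mu> j < \<mu> i"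
    and nonempty: "servers M N \<noteq> {}"
begin

abbreviation "S \<equiv> servers M N"
abbreviation "F \<equiv> servers (M - 1) N"
abbreviation "L \<equiv> PiM UNIV \<nu>"
abbreviation "fast_capacity \<equiv> \<Sum>s\<in>F. \<mu> (fst s)"

lemma F_subset: "F \<subseteq> S"
  by (rule servers_mono) simp

lemma speed_pos_server: "s \<in> S \<Longrightarrow> 0 < \<mu> (fst s)"
  using speed_pos by (auto simp: servers_def)

lemma sets_L [measurable_cong, simp]: "sets L = sets input_space"
  by (rule sets_PiM_cong) auto

lemma space_\<nu> [simp]: "space (\<nu> i) = UNIV"
  using sets_eq_imp_space_eq[OF sets_\<nu>[of i]] by simp

lemma space_L [simp]: "space L = UNIV"
  by (simp add: space_PiM)

lemma prob_L: "prob_space L"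
  by (intro prob_space_PiM prob_\<nu>)

text \<open>
  Replacing one coordinate by an independent copy does not change the product measure.
\<close>

lemma nn_integral_resample:
  assumes F [measurable]: "G \<in> borel_measurable input_space"
  shows "(\<integral>\<^sup>+w. G w \<partial>L) = (\<integral>\<^sup>+w. (\<integral>\<^sup>+v. G (w(i := v)) \<partial>\<nu> i) \<partial>L)"
proof -
  interpret A: prob_space "\<nu> i" by (rule prob_\<nu>)
  interpret B: prob_space L by (rule prob_L)
  interpret pair_sigma_finite "\<nu> i" L ..
  have upd [measurable]: "(\<lambda>(x, X). X(i := x)) \<in> \<nu> i \<Otimes>\<^sub>M L \<rightarrow>\<^sub>M L"
    unfolding case_prod_beta by (rule measurable_fun_upd[where J = UNIV]) auto
  have G [measurable]: "G \<in> borel_measurable L"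
    using F by (simp cong: measurable_cong_sets)
  have "distr (\<nu> i \<Otimes>\<^sub>M L) L (\<lambda>(x, X). X(i := x)) = L"
    using distr_pair_PiM_eq_PiM[of UNIV \<nu> i] prob_\<nu> by simp
  then have "(\<integral>\<^sup>+w. G w \<partial>L) = (\<integral>\<^sup>+w. G w \<partial>distr (\<nu> i \<Otimes>\<^sub>M L) L (\<lambda>(x, X). X(i := x)))"
    by simp
  also have "\<dots> = (\<integral>\<^sup>+p. G ((snd p)(i := fst p)) \<partial>(\<nu> i \<Otimes>\<^sub>M L))"
    by (subst nn_integral_distr) (auto simp: case_prod_beta)
  also have "\<dots> = (\<integral>\<^sup>+w. (\<integral>\<^sup>+v. G (w(i := v)) \<partial>\<nu> i) \<partial>L)"
  proof (subst nn_integral_snd[symmetric])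
    have "(\<lambda>p. G ((\<lambda>(x, X). X(i := x)) p)) \<in> borel_measurable (\<nu> i \<Otimes>\<^sub>M L)"
      by measurable
    then show "(\<lambda>p. G ((snd p)(i := fst p))) \<in> borel_measurable (\<nu> i \<Otimes>\<^sub>M L)"
      by (simp add: case_prod_beta)
  qed simp
  finally show ?thesis .
qed

lemma nn_integral_resample_le:
  assumes "G \<in> borel_measurable input_space" "\<And>w. (\<integral>\<^sup>+v. G (w(i := v)) \<partial>\<nu> i) \<le> H w"
  shows "(\<integral>\<^sup>+w. G w \<partial>L) \<le> (\<integral>\<^sup>+w. H w \<partial>L)"
  unfolding nn_integral_resample[OF assms(1), of i] by (intro nn_integral_mono assms(2))

lemma AE_positive_inputs: "AE w in L. positive_inputs M N w"
proof -
  have component: "AE w in L. 0 < w i" if "AE v in \<nu> i. 0 < v" for i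
    using AE_PiM_component[of UNIV \<nu> i "\<lambda>v. 0 < v"] prob_\<nu> that by simp
  have "AE w in L. \<forall>k. 0 < w (Gap k)"
    unfolding AE_all_countable by (intro allI component) (simp only: gap AE_exponential_pos)
  moreover have "AE w in L. \<forall>k. \<forall>j\<in>{1..M}. 0 < w (Service k j)"
    unfolding AE_all_countable
    by (intro allI AE_finite_allI component) (simp_all only: finite_atLeastAtMost service AE_exponential_pos)
  moreover have "AE w in L. \<forall>s\<in>S. \<forall>l. 0 < w (Initial_Service s l)"
    by (intro AE_finite_allI finite_servers, subst AE_all_countable, intro allI component)
       (simp only: initial AE_exponential_pos)
  ultimately show ?thesis
    unfolding positive_inputs_def by eventually_elim auto
qed

lemma nn_integral_exp_epoch_le:
  assumes x: "x < a" and "j \<le> m"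
  shows "(\<integral>\<^sup>+w. ennreal (exp (x * (epoch w m - epoch w j))) \<partial>L) \<le> ennreal ((a / (a - x)) ^ (m - j))"
  using assms(2)
proof (induction rule: dec_induct)
  case base
  show ?case using prob_space.emeasure_space_1[OF prob_L] by simp
next
  case (step m)
  have "(\<integral>\<^sup>+w. ennreal (exp (x * (epoch w (Suc m) - epoch w j))) \<partial>L)
     \<le> (\<integral>\<^sup>+w. ennreal (exp (x * (epoch w m - epoch w j))) * ennreal (a / (a - x)) \<partial>L)"
  proof (rule nn_integral_resample_le[of _ "Gap m"])
    fix w
    have "epoch (w(Gap m := v)) (Suc m) - epoch (w(Gap m := v)) j = (epoch w m - epoch w j) + v" for v
      using step by (simp add: epoch_upd_Gap) (simp add: epoch_def)
    then have "(\<integral>\<^sup>+v. ennreal (exp (x * (epoch (w(Gap m := v)) (Suc m) - epoch (w(Gap m := v)) j))) \<partial>\<nu> (Gap m))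
      = (\<integral>\<^sup>+v. ennreal (exp (x * (epoch w m - epoch w j))) * ennreal (exp (x * v)) \<partial>\<nu> (Gap m))"
      by (simp add: distrib_left exp_add ennreal_mult)
    also have "\<dots> = ennreal (exp (x * (epoch w m - epoch w j))) * ennreal (a / (a - x))"
      using x rate_pos by (subst nn_integral_cmult) (auto simp: gap nn_integral_exp_exponential)
    finally show "(\<integral>\<^sup>+v. ennreal (exp (x * (epoch (w(Gap m := v)) (Suc m) - epoch (w(Gap m := v)) j))) \<partial>\<nu> (Gap m))
      \<le> ennreal (exp (x * (epoch w m - epoch w j))) * ennreal (a / (a - x))" by simp
  qed measurable
  also have "\<dots> = (\<integral>\<^sup>+w. ennreal (exp (x * (epoch w m - epoch w j))) \<partial>L) * ennreal (a / (a - x))"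
    by (rule nn_integral_multc) measurable
  also have "\<dots> \<le> ennreal ((a / (a - x)) ^ (m - j)) * ennreal (a / (a - x))"
    by (intro mult_right_mono step) simp
  also have "\<dots> = ennreal ((a / (a - x)) ^ (Suc m - j))"
    using x rate_pos step by (simp add: ennreal_mult[symmetric] Suc_diff_le mult_ac)
  finally show ?case .
qed

abbreviation "FW z u t D \<equiv> fast_weight M \<mu> N z u t D"

lemma measurable_fast_weight [measurable]:
  assumes [measurable]: "u \<in> borel_measurable input_space" "t \<in> borel_measurable input_space"
  shows "(\<lambda>w. FW z (u w) (t w) (departures \<mu> S x0 w k)) \<in> borel_measurable input_space"
  unfolding fast_weight_def
  by (intro borel_measurable_prod measurable_queue_weight list_measurable_departures)
     (use F_subset in \<open>auto intro: assms\<close>)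

text \<open>
  Integrating out the service time of job \<open>k\<close> does not increase the expected weight. The coordinate
  \<open>Service k j\<close> that the job uses depends on the type \<open>j\<close> of the server to which it is assigned; since
  the assignment is not influenced by this coordinate, the expectation is split according to \<open>j\<close> first.
\<close>

lemma service_step:
  fixes g u t :: "(input \<Rightarrow> real) \<Rightarrow> real"
  assumes z: "z \<ge> 1"
    and [measurable]: "g \<in> borel_measurable input_space" "u \<in> borel_measurable input_space"
      "t \<in> borel_measurable input_space"
    and gd: "gap_determined g" "gap_determined u" "gap_determined t"
  shows "(\<integral>\<^sup>+w. ennreal (g w) * ennreal (FW z (u w) (t w) (departures \<mu> S x0 w (Suc k))) \<partial>L)
     \<le> (\<integral>\<^sup>+w. ennreal (g w) * ennreal (FW z (u w) (t w) (departures \<mu> S x0 w k)) \<partial>L)"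
proof -
  let ?r = "\<lambda>w. assigned \<mu> S x0 w k"
  let ?\<Phi> = "\<lambda>i w. ennreal (g w) * ennreal (FW z (u w) (t w) (departures \<mu> S x0 w i))"
  let ?I = "\<lambda>j w. if fst (?r w) = j then 1 else (0 :: ennreal)"
  have r_in: "?r w \<in> S" for w
    unfolding assigned_def using nonempty by (intro sa_jsq_in_servers) auto
  have [measurable]: "(\<lambda>w. ?r w) \<in> input_space \<rightarrow>\<^sub>M count_space UNIV"
    by (rule measurable_assigned) simp
  have split: "(\<integral>\<^sup>+w. ?\<Phi> i w \<partial>L) = (\<Sum>j\<in>{1..M}. \<integral>\<^sup>+w. ?I j w * ?\<Phi> i w \<partial>L)" for i
  proof -
    have "(\<Sum>j\<in>{1..M}. ?I j w * ?\<Phi> i w) = ?\<Phi> i w" for w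
    proof -
      have "(\<Sum>j\<in>{1..M}. ?I j w) = 1"
        using r_in[of w] by (simp add: servers_def mem_Times_iff split: prod.splits) auto
      then show ?thesis by (simp only: sum_distrib_right[symmetric] mult_1)
    qed
    then have "(\<integral>\<^sup>+w. ?\<Phi> i w \<partial>L) = (\<integral>\<^sup>+w. (\<Sum>j\<in>{1..M}. ?I j w * ?\<Phi> i w) \<partial>L)" by simp
    also have "\<dots> = (\<Sum>j\<in>{1..M}. \<integral>\<^sup>+w. ?I j w * ?\<Phi> i w \<partial>L)"
      by (rule nn_integral_sum) measurable
    finally show ?thesis .
  qed
  have "(\<integral>\<^sup>+w. ?I j w * ?\<Phi> (Suc k) w \<partial>L) \<le> (\<integral>\<^sup>+w. ?I j w * ?\<Phi> k w \<partial>L)" if j: "j \<in> {1..M}" for j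
  proof (rule nn_integral_resample_le[of _ "Service k j"])
    show "(\<lambda>w. ?I j w * ?\<Phi> (Suc k) w) \<in> borel_measurable input_space"
      by measurable
  next
    fix w
    let ?w = "\<lambda>v :: real. w(Service k j := v)"
    show "(\<integral>\<^sup>+v. ?I j (?w v) * ?\<Phi> (Suc k) (?w v) \<partial>\<nu> (Service k j)) \<le> ?I j w * ?\<Phi> k w"
    proof (cases "fst (?r w) = j")
      case False
      then show ?thesis by (simp add: assigned_upd_Service)
    next
      case True
      let ?D = "departures \<mu> S x0 w k" and ?a = "arrival_time w k"
      let ?\<sigma> = "if ?D (?r w) = [] then ?a else max ?a (last (?D (?r w)))"
      have upd: "departures \<mu> S x0 (?w v) (Suc k) = ?D(?r w := ?D (?r w) @ [?\<sigma> + v])" for v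
      proof
        fix s
        have "arrival_time (?w v) k = ?a" by (simp add: arrival_time_def)
        then show "departures \<mu> S x0 (?w v) (Suc k) s = (?D(?r w := ?D (?r w) @ [?\<sigma> + v])) s"
          using True by (simp only: departures_Suc_eq assigned_upd_Service order_refl)
             (auto simp: fcfs_departure_def)
      qed
      have "(\<integral>\<^sup>+v. ?I j (?w v) * ?\<Phi> (Suc k) (?w v) \<partial>\<nu> (Service k j))
        = (\<integral>\<^sup>+v. ennreal (g w) * ennreal (FW z (u w) (t w) (?D(?r w := ?D (?r w) @ [?\<sigma> + v]))) \<partial>\<nu> (Service k j))"
        unfolding upd by (simp only: assigned_upd_Service order_refl True simp_thms if_True mult_1 gap_determinedD[OF gd(1)]
            gap_determinedD[OF gd(2)] gap_determinedD[OF gd(3)])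
      also have "\<dots> \<le> ennreal (g w) * ennreal (FW z (u w) (t w) ?D)"
      proof (cases "?r w \<in> F")
        case False
        then have "FW z (u w) (t w) (?D(?r w := ?D (?r w) @ [?\<sigma> + v])) = FW z (u w) (t w) ?D" for v
          by (intro fast_weight_cong) auto
        then show ?thesis
          using prob_space.emeasure_space_1[OF prob_\<nu>[of "Service k j"]] by simp
      next
        case True': True
        have "(\<integral>\<^sup>+v. ennreal (g w) * ennreal (FW z (u w) (t w) (?D(?r w := ?D (?r w) @ [?\<sigma> + v]))) \<partial>\<nu> (Service k j))
          \<le> (\<integral>\<^sup>+v. (ennreal (g w) * ennreal (FW z (u w) (t w) ?D)) *
               ennreal (job_weight z (\<mu> j) (u w) (t w) ?\<sigma> v) \<partial>\<nu> (Service k j))"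
        proof (rule nn_integral_mono)
          fix v
          have "FW z (u w) (t w) (?D(?r w := ?D (?r w) @ [?\<sigma> + v]))
            \<le> FW z (u w) (t w) ?D * job_weight z (\<mu> (fst (?r w))) (u w) (t w) ?\<sigma> v"
            using z speed_pos[OF j] True True' by (intro fast_weight_snoc_le) auto
          then have "ennreal (FW z (u w) (t w) (?D(?r w := ?D (?r w) @ [?\<sigma> + v])))
            \<le> ennreal (FW z (u w) (t w) ?D) * ennreal (job_weight z (\<mu> j) (u w) (t w) ?\<sigma> v)"
            using z True by (simp add: ennreal_mult[symmetric] fast_weight_nonneg job_weight_nonneg ennreal_leI)
          then show "ennreal (g w) * ennreal (FW z (u w) (t w) (?D(?r w := ?D (?r w) @ [?\<sigma> + v])))
            \<le> (ennreal (g w) * ennreal (FW z (u w) (t w) ?D)) * ennreal (job_weight z (\<mu> j) (u w) (t w) ?\<sigma> v)"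
            by (simp add: mult.assoc mult_left_mono)
        qed
        also have "\<dots> = (ennreal (g w) * ennreal (FW z (u w) (t w) ?D)) *
            (\<integral>\<^sup>+v. ennreal (job_weight z (\<mu> j) (u w) (t w) ?\<sigma> v) \<partial>\<nu> (Service k j))"
          by (rule nn_integral_cmult) measurable
        also have "\<dots> \<le> (ennreal (g w) * ennreal (FW z (u w) (t w) ?D)) * 1"
          unfolding service[OF j]
          by (intro mult_left_mono nn_integral_job_weight_le_1 speed_pos j z) simp
        finally show ?thesis by simp
      qed
      finally show ?thesis using True by simp
    qed
  qed
  then show ?thesis unfolding split by (intro sum_mono)
qed

text \<open>
  The same for the jobs present at time \<open>0\<close>, removed one at a time from the tails of their queues.
\<close>

lemma initial_step:
  fixes g u t :: "(input \<Rightarrow> real) \<Rightarrow> real"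
  assumes z: "z \<ge> 1"
    and [measurable]: "g \<in> borel_measurable input_space" "u \<in> borel_measurable input_space"
      "t \<in> borel_measurable input_space"
    and gd: "gap_determined g" "gap_determined u" "gap_determined t"
  shows "(\<integral>\<^sup>+w. ennreal (g w) * ennreal (FW z (u w) (t w) (departures \<mu> S x0 w 0)) \<partial>L)
     \<le> (\<integral>\<^sup>+w. ennreal (g w) \<partial>L)"
proof (induction "\<Sum>s\<in>F. x0 s" arbitrary: x0)
  case 0
  then have "FW z (u w) (t w) (departures \<mu> S x0 w 0) = 1" for w
    by (simp add: fast_weight_def)
  then show ?case by simp
next
  case (Suc n)
  then obtain s where s: "s \<in> F" "x0 s \<noteq> 0" by (metis Suc_neq_Zero sum.neutral)
  then obtain l where l: "x0 s = Suc l" by (cases "x0 s") auto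
  define x1 where "x1 = x0(s := l)"
  let ?D = "\<lambda>w. departures \<mu> S x1 w 0"
  let ?\<sigma> = "\<lambda>w. \<Sum>i<l. w (Initial_Service s i)"
  have "(\<Sum>s\<in>F. x0 s) = x0 s + (\<Sum>s\<in>F - {s}. x0 s)" "(\<Sum>s\<in>F. x1 s) = x1 s + (\<Sum>s\<in>F - {s}. x1 s)"
    using s by (auto simp: sum.remove)
  moreover have "(\<Sum>s\<in>F - {s}. x1 s) = (\<Sum>s\<in>F - {s}. x0 s)"
    by (intro sum.cong) (auto simp: x1_def)
  ultimately have n: "n = (\<Sum>s\<in>F. x1 s)" using Suc.hyps(2) l by (simp add: x1_def)
  have sS: "s \<in> S" using s F_subset by auto
  have "(\<integral>\<^sup>+w. ennreal (g w) * ennreal (FW z (u w) (t w) (departures \<mu> S x0 w 0)) \<partial>L)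
    \<le> (\<integral>\<^sup>+w. ennreal (g w) * ennreal (FW z (u w) (t w) (?D w)) \<partial>L)"
  proof (rule nn_integral_resample_le[of _ "Initial_Service s l"])
    show "(\<lambda>w. ennreal (g w) * ennreal (FW z (u w) (t w) (departures \<mu> S x0 w 0))) \<in> borel_measurable input_space"
      by measurable
  next
    fix w
    let ?w = "\<lambda>v :: real. w(Initial_Service s l := v)"
    have upd: "departures \<mu> S x0 (?w v) 0 = (?D w)(s := ?D w s @ [?\<sigma> w + v])" for v
    proof
      fix s'
      show "departures \<mu> S x0 (?w v) 0 s' = ((?D w)(s := ?D w s @ [?\<sigma> w + v])) s'"
        using l by (auto simp: x1_def intro!: sum.cong simp flip: lessThan_Suc_atMost)
    qed
    have last: "?D w s \<noteq> [] \<Longrightarrow> last (?D w s) \<le> ?\<sigma> w"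
      by (cases l) (auto simp: x1_def lessThan_Suc_atMost[symmetric])
    have "(\<integral>\<^sup>+v. ennreal (g (?w v)) * ennreal (FW z (u (?w v)) (t (?w v)) (departures \<mu> S x0 (?w v) 0)) \<partial>\<nu> (Initial_Service s l))
      = (\<integral>\<^sup>+v. ennreal (g w) * ennreal (FW z (u w) (t w) ((?D w)(s := ?D w s @ [?\<sigma> w + v]))) \<partial>\<nu> (Initial_Service s l))"
      unfolding upd by (simp only: gap_determinedD[OF gd(1)] gap_determinedD[OF gd(2)] gap_determinedD[OF gd(3)])
    also have "\<dots> \<le> (\<integral>\<^sup>+v. (ennreal (g w) * ennreal (FW z (u w) (t w) (?D w))) *
               ennreal (job_weight z (\<mu> (fst s)) (u w) (t w) (?\<sigma> w) v) \<partial>\<nu> (Initial_Service s l))"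
    proof (rule nn_integral_mono)
      fix v
      have "FW z (u w) (t w) ((?D w)(s := ?D w s @ [?\<sigma> w + v]))
        \<le> FW z (u w) (t w) (?D w) * job_weight z (\<mu> (fst s)) (u w) (t w) (?\<sigma> w) v"
        using z speed_pos_server[OF sS] s last by (intro fast_weight_snoc_le) (auto simp: less_imp_le)
      then have "ennreal (FW z (u w) (t w) ((?D w)(s := ?D w s @ [?\<sigma> w + v])))
        \<le> ennreal (FW z (u w) (t w) (?D w)) * ennreal (job_weight z (\<mu> (fst s)) (u w) (t w) (?\<sigma> w) v)"
        using z by (simp add: ennreal_mult[symmetric] fast_weight_nonneg job_weight_nonneg ennreal_leI)
      then show "ennreal (g w) * ennreal (FW z (u w) (t w) ((?D w)(s := ?D w s @ [?\<sigma> w + v])))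
        \<le> (ennreal (g w) * ennreal (FW z (u w) (t w) (?D w))) * ennreal (job_weight z (\<mu> (fst s)) (u w) (t w) (?\<sigma> w) v)"
        by (simp add: mult.assoc mult_left_mono)
    qed
    also have "\<dots> = (ennreal (g w) * ennreal (FW z (u w) (t w) (?D w))) *
        (\<integral>\<^sup>+v. ennreal (job_weight z (\<mu> (fst s)) (u w) (t w) (?\<sigma> w) v) \<partial>\<nu> (Initial_Service s l))"
      by (rule nn_integral_cmult) measurable
    also have "\<dots> \<le> (ennreal (g w) * ennreal (FW z (u w) (t w) (?D w))) * 1"
      unfolding initial[OF sS]
      by (intro mult_left_mono nn_integral_job_weight_le_1 speed_pos_server sS z) simp
    finally show "(\<integral>\<^sup>+v. ennreal (g (?w v)) * ennreal (FW z (u (?w v)) (t (?w v)) (departures \<mu> S x0 (?w v) 0)) \<partial>\<nu> (Initial_Service s l))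
      \<le> ennreal (g w) * ennreal (FW z (u w) (t w) (?D w))" by simp
  qed
  also have "\<dots> \<le> (\<integral>\<^sup>+w. ennreal (g w) \<partial>L)"
    by (rule Suc.hyps(1)[OF n])
  finally show ?case .
qed

lemma nn_integral_fast_weight_le:
  fixes g u t :: "(input \<Rightarrow> real) \<Rightarrow> real"
  assumes "z \<ge> 1"
    and "g \<in> borel_measurable input_space" "u \<in> borel_measurable input_space"
      "t \<in> borel_measurable input_space"
    and "gap_determined g" "gap_determined u" "gap_determined t"
  shows "(\<integral>\<^sup>+w. ennreal (g w) * ennreal (FW z (u w) (t w) (departures \<mu> S x0 w k)) \<partial>L)
     \<le> (\<integral>\<^sup>+w. ennreal (g w) \<partial>L)"
proof (induction k)
  case 0
  show ?case by (rule initial_step[OF assms])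
next
  case (Suc k)
  show ?case using service_step[OF assms] Suc.IH by (rule order_trans)
qed

text \<open>
  The number of departures from fast servers during a window of \<open>m - j\<close> interarrival times has at most
  the exponential moments of a Poisson process of rate \<open>fast_capacity\<close> over that window, whose length
  is a sum of \<open>m - j\<close> exponential variables of rate \<open>a\<close>.
\<close>

lemma num_departures_mgf_le:
  assumes z: "z \<ge> 1" and cap: "(z - 1) * fast_capacity < a" and jm: "j \<le> m"
  shows "(\<integral>\<^sup>+w. ennreal (z ^ num_departures M \<mu> N x0 w k (\<lambda>d. epoch w j \<le> d \<and> d \<le> epoch w m)) \<partial>L)
     \<le> ennreal ((a / (a - (z - 1) * fast_capacity)) ^ (m - j))"
proof -
  let ?g = "\<lambda>w. exp ((z - 1) * fast_capacity * (epoch w m - epoch w j))"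
  have gd: "gap_determined ?g"
    using gap_determined_epoch[of m] gap_determined_epoch[of j] unfolding gap_determined_def by metis
  have "(\<integral>\<^sup>+w. ennreal (z ^ num_departures M \<mu> N x0 w k (\<lambda>d. epoch w j \<le> d \<and> d \<le> epoch w m)) \<partial>L)
    \<le> (\<integral>\<^sup>+w. ennreal (?g w) * ennreal (FW z (epoch w j) (epoch w m) (departures \<mu> S x0 w k)) \<partial>L)"
  proof (rule nn_integral_mono_AE)
    show "AE w in L. ennreal (z ^ num_departures M \<mu> N x0 w k (\<lambda>d. epoch w j \<le> d \<and> d \<le> epoch w m))
       \<le> ennreal (?g w) * ennreal (FW z (epoch w j) (epoch w m) (departures \<mu> S x0 w k))"
      using AE_positive_inputs
    proof eventually_elim
      case (elim w)
      have "epoch w j \<le> epoch w m"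
        unfolding epoch_def using elim jm
        by (intro sum_mono2) (auto simp: positive_inputs_def less_imp_le)
      then have "z ^ num_departures M \<mu> N x0 w k (\<lambda>d. epoch w j \<le> d \<and> d \<le> epoch w m)
         \<le> ?g w * FW z (epoch w j) (epoch w m) (departures \<mu> S x0 w k)"
        using z less_imp_le[OF speed_pos_server] F_subset by (intro power_num_departures_le) auto
      then show ?case
        using z by (simp add: ennreal_mult[symmetric] fast_weight_nonneg ennreal_leI)
    qed
  qed
  also have "\<dots> \<le> (\<integral>\<^sup>+w. ennreal (?g w) \<partial>L)"
    using z gd by (intro nn_integral_fast_weight_le) (auto simp: gap_determined_epoch)
  also have "\<dots> \<le> ennreal ((a / (a - (z - 1) * fast_capacity)) ^ (m - j))"
    using cap jm by (rule nn_integral_exp_epoch_le)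
  finally show ?thesis .
qed

end


section \<open>Tail bounds and excursions\<close>

context input_law
begin

lemma sets_Collect_input: "Measurable.pred input_space Q \<Longrightarrow> {w. Q w} \<in> sets input_space"
  by (simp add: pred_def space_PiM)

lemma UNIV_sets_input [simp]: "UNIV \<in> sets input_space"
  using sets.top[of input_space] by (simp add: space_PiM)

text \<open>
  The Chernoff bound for the increments of the Lindley recursion. A value \<open>q < 1\<close> expresses the
  negative drift: \<open>z q\<close> bounds the factor that each interarrival time contributes to the moment, and
  the arrival at its end contributes \<open>1 / z\<close>.
\<close>

lemma num_departures_tail_le:
  assumes z: "z > 1" and cap: "(z - 1) * fast_capacity < a" and jm: "j \<le> m"
    and q: "a / (a - (z - 1) * fast_capacity) \<le> z * q"
  shows "emeasure L {w. x + real (m - j)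
      \<le> real (num_departures M \<mu> N x0 w k (\<lambda>d. epoch w j \<le> d \<and> d \<le> epoch w (Suc m)))}
     \<le> ennreal (z powr (1 - x) * q ^ (Suc m - j))"
proof -
  let ?n = "\<lambda>w. num_departures M \<mu> N x0 w k (\<lambda>d. epoch w j \<le> d \<and> d \<le> epoch w (Suc m))"
  let ?p = "a / (a - (z - 1) * fast_capacity)"
  have [measurable]: "?n \<in> input_space \<rightarrow>\<^sub>M count_space UNIV"
    by (rule measurable_num_departures) measurable
  have p0: "0 \<le> ?p" using cap rate_pos by simp
  have "0 \<le> z * q" using p0 q by linarith
  then have q0: "0 \<le> q" using z by (simp add: zero_le_mult_iff)
  have "emeasure L {w \<in> space L. real (?n w) \<ge> x + real (m - j)}
     \<le> ennreal (exp (- ln z * (x + real (m - j)))) * (\<integral>\<^sup>+w. ennreal (exp (ln z * real (?n w))) * indicator (space L) w \<partial>L)"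
    using z by (intro Chernoff_ineq_nn_integral_ge) (auto simp: ln_gt_zero)
  also have "(\<integral>\<^sup>+w. ennreal (exp (ln z * real (?n w))) * indicator (space L) w \<partial>L) = (\<integral>\<^sup>+w. ennreal (z ^ ?n w) \<partial>L)"
    using z by (intro nn_integral_cong) (simp add: exp_of_nat2_mult)
  also have "\<dots> \<le> ennreal (?p ^ (Suc m - j))"
    using z cap jm by (intro num_departures_mgf_le) auto
  also have "\<dots> \<le> ennreal ((z * q) ^ (Suc m - j))"
    using q p0 by (intro ennreal_leI power_mono)
  finally have "emeasure L {w \<in> space L. real (?n w) \<ge> x + real (m - j)}
     \<le> ennreal (exp (- ln z * (x + real (m - j)))) * ennreal ((z * q) ^ (Suc m - j))"
    by (simp add: mult_left_mono)
  also have "\<dots> = ennreal (exp (- ln z * (x + real (m - j))) * (z * q) ^ (Suc m - j))"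
    using z q0 by (simp add: ennreal_mult)
  also have "exp (- ln z * (x + real (m - j))) * (z * q) ^ (Suc m - j) = z powr (1 - x) * q ^ (Suc m - j)"
  proof -
    have "exp (ln z * (real (m - j) + 1)) = z ^ (m - j) * z"
      using z by (simp only: distrib_left exp_add exp_of_nat2_mult mult_1_right) simp
    then have "z ^ (Suc m - j) = exp (ln z * (real (m - j) + 1))"
      using jm by (simp add: Suc_diff_le)
    then have "exp (- ln z * (x + real (m - j))) * z ^ (Suc m - j) = exp (ln z * (1 - x))"
      by (simp add: algebra_simps flip: exp_add)
    then show ?thesis
      using z by (simp add: power_mult_distrib powr_def mult_ac)
  qed
  finally show ?thesis by (simp add: space_PiM)
qed

lemma epoch_le_tail:
  assumes "\<theta> > 0"
  shows "emeasure L {w. epoch w K \<le> T} \<le> ennreal (exp (\<theta> * T) * (a / (a + \<theta>)) ^ K)"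
proof -
  have "emeasure L {w \<in> space L. epoch w K \<le> T}
     \<le> ennreal (exp (\<theta> * T)) * (\<integral>\<^sup>+w. ennreal (exp (- \<theta> * epoch w K)) * indicator (space L) w \<partial>L)"
    using assms by (intro Chernoff_ineq_nn_integral_le) auto
  also have "(\<integral>\<^sup>+w. ennreal (exp (- \<theta> * epoch w K)) * indicator (space L) w \<partial>L)
     = (\<integral>\<^sup>+w. ennreal (exp (- \<theta> * (epoch w K - epoch w 0))) \<partial>L)"
    by (intro nn_integral_cong) (simp add: epoch_def)
  also have "\<dots> \<le> ennreal ((a / (a - - \<theta>)) ^ (K - 0))"
    using assms rate_pos by (intro nn_integral_exp_epoch_le) auto
  finally show ?thesis
    using assms rate_pos by (simp add: ennreal_mult mult_left_mono)
qed

lemma epoch_gt_tail: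
  "emeasure L {w. t < epoch w l} \<le> ennreal (exp (- (a / 2 * t)) * 2 ^ l)"
proof -
  have "emeasure L {w. t < epoch w l} \<le> emeasure L {w \<in> space L. epoch w l \<ge> t}"
  proof (rule emeasure_mono)
    show "{w \<in> space L. epoch w l \<ge> t} \<in> sets L" by measurable
  qed auto
  also have "\<dots> \<le> ennreal (exp (- (a / 2) * t)) * (\<integral>\<^sup>+w. ennreal (exp (a / 2 * epoch w l)) * indicator (space L) w \<partial>L)"
    using rate_pos by (intro Chernoff_ineq_nn_integral_ge) auto
  also have "(\<integral>\<^sup>+w. ennreal (exp (a / 2 * epoch w l)) * indicator (space L) w \<partial>L)
     = (\<integral>\<^sup>+w. ennreal (exp (a / 2 * (epoch w l - epoch w 0))) \<partial>L)"
    by (intro nn_integral_cong) (simp add: epoch_def)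
  also have "\<dots> \<le> ennreal ((a / (a - a / 2)) ^ (l - 0))"
    using rate_pos by (intro nn_integral_exp_epoch_le) auto
  also have "a / (a - a / 2) = 2"
    using rate_pos by (simp add: field_simps)
  finally show ?thesis
    by (simp add: ennreal_mult mult_left_mono)
qed

text \<open>
  The exceptional set of inputs for a fixed initial state with at most \<open>\<kappa>\<close> idle fast servers. Apart
  from a null set it has four parts: the first \<open>K\<close> jobs do not cover \<open>[0, T]\<close>;
  fewer than \<open>l\<close> jobs arrive before \<open>t0\<close>
  (probability at most \<open>\<delta>\<close>); an excursion that starts at an arrival reaches height \<open>\<epsilon>\<close>; the
  excursion that starts from the initial state is at height \<open>\<epsilon>\<close> after at least \<open>l\<close> arrivals.
\<close>

lemma excursion_bound:
  assumes z: "z > 1" and cap: "(z - 1) * fast_capacity < a"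
    and q: "a / (a - (z - 1) * fast_capacity) \<le> z * q" "q \<le> 1"
    and t0: "0 \<le> t0" and \<theta>: "\<theta> > 0"
    and I0: "real (card {s \<in> F. x0 s = 0}) \<le> \<kappa>"
    and \<delta>: "emeasure L {w. t0 < epoch w l} \<le> ennreal \<delta>" "0 \<le> \<delta>"
  shows "\<exists>E\<in>sets input_space. {w. \<exists>t\<in>{t0..T}. \<epsilon> < real (idle_fast M \<mu> N x0 w t)} \<subseteq> E \<and>
     emeasure L E \<le> ennreal (exp (\<theta> * T) * (a / (a + \<theta>)) ^ K + \<delta> +
       real K ^ 2 * z powr (1 - \<epsilon>) + real K * (z powr (1 - (\<epsilon> - \<kappa>)) * q ^ l))"
proof -
  let ?n = "\<lambda>j m w. num_departures M \<mu> N x0 w K (\<lambda>d. epoch w j \<le> d \<and> d \<le> epoch w (Suc m))"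
  have [measurable]: "?n j m \<in> input_space \<rightarrow>\<^sub>M count_space UNIV" for j m
    by (rule measurable_num_departures) measurable
  let ?J = "{(m, j). m < K \<and> j \<le> m}"
  have J: "finite ?J" "card ?J \<le> K ^ 2"
  proof -
    have sub: "?J \<subseteq> {..<K} \<times> {..<K}" by auto
    then show "finite ?J" by (rule finite_subset) auto
    show "card ?J \<le> K ^ 2" using card_mono[OF _ sub] by (simp add: power2_eq_square)
  qed
  obtain Z where Z: "{w. \<not> positive_inputs M N w} \<subseteq> Z" "emeasure L Z = 0" "Z \<in> sets L"
    using AE_positive_inputs by (auto elim: AE_E)
  let ?A = "\<lambda>(m, j). {w. \<epsilon> + real (m - j) \<le> real (?n j m w)}"
  let ?B = "\<lambda>m. {w. (\<epsilon> - \<kappa>) + real (m - 0) \<le> real (?n 0 m w)}"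
  define E where "E = Z \<union> {w. epoch w K \<le> T} \<union> {w. t0 < epoch w l} \<union> (\<Union>(?A ` ?J)) \<union> (\<Union>(?B ` {l..<K}))"
  have qnn: "0 \<le> q"
  proof -
    have "0 \<le> a / (a - (z - 1) * fast_capacity)" using cap rate_pos by simp
    then have "0 \<le> z * q" using q by linarith
    then show ?thesis using z by (simp add: zero_le_mult_iff)
  qed
  have sets: "Z \<in> sets L" "{w. epoch w K \<le> T} \<in> sets L" "{w. t0 < epoch w l} \<in> sets L"
     "(\<Union>(?A ` ?J)) \<in> sets L" "(\<Union>(?B ` {l..<K})) \<in> sets L"
    "?A p \<in> sets L" "?B m \<in> sets L" for p m
    unfolding sets_L using Z(3) J(1)
    by (auto intro!: sets_Collect_input sets.finite_UN split: prod.splits)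
  have E_meas: "E \<in> sets input_space"
    using sets unfolding E_def sets_L by blast
  have A: "emeasure L (\<Union>(?A ` ?J)) \<le> ennreal (real K ^ 2 * z powr (1 - \<epsilon>))"
  proof -
    have "emeasure L (\<Union>(?A ` ?J)) \<le> (\<Sum>p\<in>?J. emeasure L (?A p))"
      using J(1) sets(6) by (intro emeasure_subadditive_finite) auto
    also have "\<dots> \<le> (\<Sum>p\<in>?J. ennreal (z powr (1 - \<epsilon>)))"
    proof (intro sum_mono)
      fix p assume "p \<in> ?J"
      then obtain m j where p: "p = (m, j)" and "j \<le> m" by auto
      have "emeasure L (?A (m, j)) \<le> ennreal (z powr (1 - \<epsilon>) * q ^ (Suc m - j))"
        using num_departures_tail_le[OF z cap \<open>j \<le> m\<close> q(1)] by simp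
      also have "\<dots> \<le> ennreal (z powr (1 - \<epsilon>))"
        using qnn q(2) by (intro ennreal_leI mult_left_le power_le_one) auto
      finally show "emeasure L (?A p) \<le> ennreal (z powr (1 - \<epsilon>))" unfolding p .
    qed
    also have "\<dots> = ennreal (real (card ?J) * z powr (1 - \<epsilon>))"
      by (simp add: ennreal_mult ennreal_of_nat_eq_real_of_nat)
    also have "\<dots> \<le> ennreal (real K ^ 2 * z powr (1 - \<epsilon>))"
      using J(2) by (intro ennreal_leI mult_right_mono) (auto simp flip: of_nat_power)
    finally show ?thesis .
  qed
  have B: "emeasure L (\<Union>(?B ` {l..<K})) \<le> ennreal (real K * (z powr (1 - (\<epsilon> - \<kappa>)) * q ^ l))"
  proof -
    have "emeasure L (\<Union>(?B ` {l..<K})) \<le> (\<Sum>m\<in>{l..<K}. emeasure L (?B m))"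
      using sets(7) by (intro emeasure_subadditive_finite) auto
    also have "\<dots> \<le> (\<Sum>m\<in>{l..<K}. ennreal (z powr (1 - (\<epsilon> - \<kappa>)) * q ^ l))"
    proof (intro sum_mono)
      fix m assume m: "m \<in> {l..<K}"
      have "emeasure L (?B m) \<le> ennreal (z powr (1 - (\<epsilon> - \<kappa>)) * q ^ (Suc m - 0))"
        by (rule num_departures_tail_le[OF z cap _ q(1)]) simp
      also have "\<dots> \<le> ennreal (z powr (1 - (\<epsilon> - \<kappa>)) * q ^ l)"
        using qnn q(2) m by (intro ennreal_leI mult_left_mono power_decreasing) auto
      finally show "emeasure L (?B m) \<le> ennreal (z powr (1 - (\<epsilon> - \<kappa>)) * q ^ l)" .
    qed
    also have "\<dots> = ennreal (real (K - l) * (z powr (1 - (\<epsilon> - \<kappa>)) * q ^ l))"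
      using qnn by (simp add: ennreal_mult ennreal_of_nat_eq_real_of_nat)
    also have "\<dots> \<le> ennreal (real K * (z powr (1 - (\<epsilon> - \<kappa>)) * q ^ l))"
      using qnn by (intro ennreal_leI mult_right_mono) auto
    finally show ?thesis .
  qed
  have "emeasure L E \<le> emeasure L Z + emeasure L {w. epoch w K \<le> T} + emeasure L {w. t0 < epoch w l}
      + emeasure L (\<Union>(?A ` ?J)) + emeasure L (\<Union>(?B ` {l..<K}))"
    unfolding E_def
    by (intro order_trans[OF emeasure_subadditive] add_mono order_refl sets.Un sets)
  also have "\<dots> \<le> 0 + ennreal (exp (\<theta> * T) * (a / (a + \<theta>)) ^ K) + ennreal \<delta>
      + ennreal (real K ^ 2 * z powr (1 - \<epsilon>)) + ennreal (real K * (z powr (1 - (\<epsilon> - \<kappa>)) * q ^ l))"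
    using Z(2) \<theta> by (intro add_mono A B \<delta> epoch_le_tail) auto
  also have "\<dots> = ennreal (exp (\<theta> * T) * (a / (a + \<theta>)) ^ K + \<delta> +
       real K ^ 2 * z powr (1 - \<epsilon>) + real K * (z powr (1 - (\<epsilon> - \<kappa>)) * q ^ l))"
    using qnn \<delta>(2) \<theta> rate_pos by simp
  finally have bound: "emeasure L E \<le> \<dots>" .
  have "{w. \<exists>t\<in>{t0..T}. \<epsilon> < real (idle_fast M \<mu> N x0 w t)} \<subseteq> E"
  proof safe
    fix w t assume t: "t \<in> {t0..T}" and big: "\<epsilon> < real (idle_fast M \<mu> N x0 w t)"
    show "w \<in> E"
    proof (cases "w \<in> Z \<or> epoch w K \<le> T \<or> t0 < epoch w l")
      case True then show ?thesis by (auto simp: E_def)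
    next
      case False
      then have "positive_inputs M N w" using Z by auto
      then have path: "positive_path M \<mu> N w"
        using speeds nonempty by unfold_locales
      have "0 \<le> t" "t < epoch w K" using t t0 False by auto
      from positive_path.idle_fast_bound[OF path this] obtain m j where
        mj: "m < K" "j \<le> m" "epoch w m \<le> t" "t < epoch w (Suc m)"
          "idle_fast M \<mu> N x0 w t + (m - j) \<le> (if j = 0 then card {s \<in> F. x0 s = 0} else 0) + ?n j m w"
        by blast
      have le: "real (idle_fast M \<mu> N x0 w t) + real (m - j)
        \<le> (if j = 0 then real (card {s \<in> F. x0 s = 0}) else 0) + real (?n j m w)"
        using of_nat_mono[OF mj(5), where ?'a = real] by (simp split: if_splits)
      show ?thesis
      proof (cases "j = 0")
        case True
        have "epoch w l < epoch w (Suc m)" using False t mj(4) by auto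
        then have "l \<le> m" using positive_path.epoch_le_iff[OF path, of "Suc m" l] by auto
        moreover have "w \<in> ?B m" using True le I0 big by simp
        ultimately show ?thesis using mj(1) unfolding E_def by auto
      next
        case False
        then have "w \<in> ?A (m, j)" "(m, j) \<in> ?J" using le big mj by auto
        then show ?thesis unfolding E_def by blast
      qed
    qed
  qed
  with E_meas bound show ?thesis by blast
qed

end

section \<open>From the inputs to a system\<close>

text \<open>
  Initial queue lengths matter at existing servers only. Hence the initial state takes countably many
  values, and one may condition on it by summation.
\<close>

lemma departures_cong:
  assumes "finite S" "S \<noteq> {}" "\<And>s. s \<in> S \<Longrightarrow> x0 s = x1 s" "s \<in> S"
  shows "departures \<mu> S x0 w k s = departures \<mu> S x1 w k s"
  using assms(4)
proof (induction k arbitrary: s)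
  case 0
  then show ?case using assms(3) by simp
next
  case (Suc k)
  have "restrict (\<lambda>s. length (filter (\<lambda>d. arrival_time w k \<le> d) (departures \<mu> S x0 w k s))) S
      = restrict (\<lambda>s. length (filter (\<lambda>d. arrival_time w k \<le> d) (departures \<mu> S x1 w k s))) S"
    using Suc.IH by auto
  then have "assigned \<mu> S x0 w k = assigned \<mu> S x1 w k"
    unfolding assigned_def by (metis sa_jsq_restrict)
  then show ?case
    using Suc.IH[OF Suc.prems] by (simp only: departures_Suc_eq)
qed

lemma idle_fast_restrict:
  assumes "servers M N \<noteq> {}"
  shows "idle_fast M \<mu> N (restrict x0 (servers M N)) w t = idle_fast M \<mu> N x0 w t"
proof -
  have "queue_length \<mu> (servers M N) (restrict x0 (servers M N)) w t s = queue_length \<mu> (servers M N) x0 w t s"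
    if "s \<in> servers (M - 1) N" for s
    unfolding queue_length_def using that servers_mono[of "M - 1" M N] assms
    by (subst departures_cong[where ?x1.0 = x0]) auto
  then have "{s \<in> servers (M - 1) N. queue_length \<mu> (servers M N) (restrict x0 (servers M N)) w t s = 0}
    = {s \<in> servers (M - 1) N. queue_length \<mu> (servers M N) x0 w t s = 0}" by auto
  then show ?thesis by (simp only: idle_fast_def)
qed

lemma sa_jsq_system_input_law:
  assumes sys: "sa_jsq_system M \<mu> N a P X0 W" and "0 < a" "\<And>j. j \<in> {1..M} \<Longrightarrow> 0 < \<mu> j"
    and "\<And>i j. 1 \<le> i \<Longrightarrow> i < j \<Longrightarrow> j \<le> M \<Longrightarrow> \<mu> j < \<mu> i" and "servers M N \<noteq> {}"
  shows "input_law M \<mu> N a (\<lambda>i. distr P borel (W i))"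
    and "(\<lambda>\<omega> i. W i \<omega>) \<in> P \<rightarrow>\<^sub>M input_space"
    and "distr P input_space (\<lambda>\<omega> i. W i \<omega>) = PiM UNIV (\<lambda>i. distr P borel (W i))"
proof -
  interpret prob_space P using sys by (simp add: sa_jsq_system_def)
  have ind: "indep_vars (\<lambda>_. borel) W UNIV" using sys by (simp add: sa_jsq_system_def)
  then have rv [measurable]: "W i \<in> borel_measurable P" for i
    by (auto simp: indep_vars_def)
  show "(\<lambda>\<omega> i. W i \<omega>) \<in> P \<rightarrow>\<^sub>M input_space"
    by (rule measurable_PiM_single') auto
  show "distr P input_space (\<lambda>\<omega> i. W i \<omega>) = PiM UNIV (\<lambda>i. distr P borel (W i))"
    using indep_vars_iff_distr_eq_PiM[where I = UNIV and M' = "\<lambda>_. borel" and X = W] ind rv by (simp add: restrict_def)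
  have distr: "distr P borel X = density lborel f" if "distributed P lborel X f" for X and f :: "real \<Rightarrow> real"
  proof -
    have "distr P borel X = distr P lborel X" by (rule distr_cong) auto
    then show ?thesis using distributed_distr_eq_density[OF that] by simp
  qed
  show "input_law M \<mu> N a (\<lambda>i. distr P borel (W i))"
    using sys assms(2-5)
    by (intro input_law.intro prob_space_distr) (auto simp: sa_jsq_system_def distr)
qed

text \<open>
  Conditioning on a discrete random variable \<open>X\<close> that is independent of \<open>W\<close>: the probability is an
  average over the values \<open>x\<close> of \<open>X\<close> of the probabilities that \<open>W\<close> hits \<open>E x\<close>.
\<close>

lemma emeasure_mixture_le:
  assumes "prob_space P" and I: "countable I" and X: "X \<in> P \<rightarrow>\<^sub>M count_space I" and W: "W \<in> P \<rightarrow>\<^sub>M K"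
    and indep: "prob_space.indep_set P (sets (vimage_algebra (space P) X (count_space I)))
        (sets (vimage_algebra (space P) W K))"
    and E: "\<And>x. x \<in> I \<Longrightarrow> E x \<in> sets K" "\<And>x. x \<in> I \<Longrightarrow> emeasure (distr P K W) (E x) \<le> B"
  shows "{\<omega> \<in> space P. W \<omega> \<in> E (X \<omega>)} \<in> sets P \<and> emeasure P {\<omega> \<in> space P. W \<omega> \<in> E (X \<omega>)} \<le> B"
proof -
  interpret prob_space P by fact
  let ?X = "\<lambda>x. X -` {x} \<inter> space P" and ?W = "\<lambda>x. W -` E x \<inter> space P"
  have sX: "?X x \<in> sets P" if "x \<in> I" for x using X that by (intro measurable_sets[OF X]) auto
  have sW: "?W x \<in> sets P" if "x \<in> I" for x using E(1)[OF that] by (rule measurable_sets[OF W])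
  have split: "{\<omega> \<in> space P. W \<omega> \<in> E (X \<omega>)} = (\<Union>x\<in>I. ?X x \<inter> ?W x)"
    using measurable_space[OF X] by auto
  have "emeasure P (?X x \<inter> ?W x) \<le> emeasure P (?X x) * B" if x: "x \<in> I" for x
  proof -
    have "prob (?X x \<inter> ?W x) = prob (?X x) * prob (?W x)"
      using x E(1) by (intro indep_setD[OF indep] in_vimage_algebra) auto
    then have "emeasure P (?X x \<inter> ?W x) = emeasure P (?X x) * emeasure P (?W x)"
      by (simp add: emeasure_eq_measure ennreal_mult)
    also have "emeasure P (?W x) = emeasure (distr P K W) (E x)"
      using E(1)[OF x] by (simp add: emeasure_distr[OF W])
    also have "\<dots> \<le> B" by (rule E(2)[OF x])
    finally show ?thesis by (simp add: mult_left_mono)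
  qed
  then have "(\<integral>\<^sup>+x. emeasure P (?X x \<inter> ?W x) \<partial>count_space I) \<le> (\<integral>\<^sup>+x. emeasure P (?X x) * B \<partial>count_space I)"
    by (intro nn_integral_mono) auto
  also have "\<dots> = (\<integral>\<^sup>+x. emeasure P (?X x) \<partial>count_space I) * B"
    by (rule nn_integral_multc) simp
  also have "(\<integral>\<^sup>+x. emeasure P (?X x) \<partial>count_space I) = emeasure P (\<Union>x\<in>I. ?X x)"
    using sX I by (intro emeasure_UN_countable[symmetric]) (auto simp: disjoint_family_on_def)
  also have "(\<Union>x\<in>I. ?X x) = space P" using measurable_space[OF X] by auto
  also have "(\<integral>\<^sup>+x. emeasure P (?X x \<inter> ?W x) \<partial>count_space I) = emeasure P (\<Union>x\<in>I. ?X x \<inter> ?W x)"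
    using sX sW I by (intro emeasure_UN_countable[symmetric]) (auto simp: disjoint_family_on_def)
  finally have "emeasure P (\<Union>x\<in>I. ?X x \<inter> ?W x) \<le> B" by (simp add: emeasure_space_1)
  moreover have "(\<Union>x\<in>I. ?X x \<inter> ?W x) \<in> sets P"
    using I sX sW by (intro sets.countable_UN') auto
  ultimately show ?thesis unfolding split by blast
qed

lemma countable_queue_lengths: "finite S \<Longrightarrow> countable (PiE S (\<lambda>_. UNIV :: nat set))"
  by (rule countable_PiE) auto

lemma measurable_restrict_initial:
  assumes "sa_jsq_system M \<mu> N a P X0 W"
  shows "(\<lambda>\<omega>. restrict (X0 \<omega>) (servers M N)) \<in> P \<rightarrow>\<^sub>M count_space (PiE (servers M N) (\<lambda>_. UNIV))"
proof -
  have "PiM (servers M N) (\<lambda>_. count_space (UNIV :: nat set)) = count_space (PiE (servers M N) (\<lambda>_. UNIV))"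
    by (rule count_space_PiM_finite) auto
  then show ?thesis using assms by (simp add: sa_jsq_system_def)
qed

text \<open>
  Without measurability the law of the initial value would be meaningless, and weak convergence would
  say nothing about the probability of a large negative initial value.
\<close>

lemma measurable_Y1_fast:
  assumes "M \<ge> 1" and ne: "servers M N \<noteq> {}" and sys: "sa_jsq_system M \<mu> N a P X0 W"
    and W: "(\<lambda>\<omega> i. W i \<omega>) \<in> P \<rightarrow>\<^sub>M input_space"
  shows "(\<lambda>\<omega>. Y1_fast M \<mu> n N (X0 \<omega>) (\<lambda>i. W i \<omega>) t) \<in> borel_measurable P"
proof -
  let ?X = "\<lambda>\<omega>. restrict (X0 \<omega>) (servers M N)"
  have "(\<lambda>\<omega>. idle_fast M \<mu> N (?X \<omega>) (\<lambda>i. W i \<omega>) t) \<in> P \<rightarrow>\<^sub>M count_space UNIV"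
    by (rule measurable_compose_countable'[OF _ measurable_restrict_initial[OF sys] countable_queue_lengths,
          of "\<lambda>x \<omega>. idle_fast M \<mu> N x (\<lambda>i. W i \<omega>) t"])
       (auto intro: measurable_compose[OF W measurable_idle_fast])
  then have [measurable]: "(\<lambda>\<omega>. idle_fast M \<mu> N (X0 \<omega>) (\<lambda>i. W i \<omega>) t) \<in> P \<rightarrow>\<^sub>M count_space UNIV"
    by (simp add: idle_fast_restrict[OF ne])
  show ?thesis unfolding Y1_fast_eq_idle_fast[OF \<open>M \<ge> 1\<close>] by measurable
qed

text \<open>
  No job arrives by time \<open>0\<close>, so initially empty servers are still empty then. This is how the
  hypothesis on the initial values of the process controls the initial state.
\<close>

lemma (in positive_path) initially_idle_le: "card {s \<in> F. x0 s = 0} \<le> idle_fast M \<mu> N x0 w 0"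
proof -
  have "num_arrivals w 0 = 0"
    using strict_mono_epoch by (intro num_arrivals_eq) (auto simp: strict_mono_def simp flip: epoch_0)
  then show ?thesis
    unfolding idle_fast_def queue_length_def by (intro card_mono) auto
qed

text \<open>
  The estimate for a single system. If the scaled process starts above \<open>- \<kappa>\<close>, then the initial state has
  fewer than \<open>\<kappa> sqrt n\<close> idle fast servers, and the set of bad inputs for this state is small.
\<close>

lemma system_exceedance_bound:
  fixes P :: "'a measure" and M n :: nat and \<mu> :: "nat \<Rightarrow> real" and N :: "nat \<Rightarrow> nat"
    and X0 :: "'a \<Rightarrow> server \<Rightarrow> nat" and W :: "input \<Rightarrow> 'a \<Rightarrow> real"
  defines "Y \<equiv> \<lambda>t \<omega>. Y1_fast M \<mu> n N (X0 \<omega>) (\<lambda>i. W i \<omega>) t"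
  assumes M: "M \<ge> 2" and n: "n \<ge> 1" "(\<Sum>j = 1..M. N j) = n"
    and sys: "sa_jsq_system M \<mu> N a P X0 W" and a: "0 < a" "\<And>j. j \<in> {1..M} \<Longrightarrow> 0 < \<mu> j"
    and dec: "\<And>i j. 1 \<le> i \<Longrightarrow> i < j \<Longrightarrow> j \<le> M \<Longrightarrow> \<mu> j < \<mu> i"
    and z: "z > 1" and cap: "(z - 1) * (\<Sum>s\<in>servers (M - 1) N. \<mu> (fst s)) < a"
    and q: "a / (a - (z - 1) * (\<Sum>s\<in>servers (M - 1) N. \<mu> (fst s))) \<le> z * q" "q \<le> 1"
    and t0: "0 \<le> t0" "t0 \<le> T" and \<theta>: "\<theta> > 0" and \<kappa>: "\<kappa> > 0"
  shows "outer_measure_of P {\<omega> \<in> space P. (SUP s\<in>{t0..T}. \<bar>Y s \<omega>\<bar>) > \<epsilon>}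
    \<le> ennreal (cdf (distr P borel (Y 0)) (- \<kappa>)) +
      ennreal (exp (\<theta> * T) * (a / (a + \<theta>)) ^ K + (if l = 0 then 0 else exp (- (a / 2 * t0)) * 2 ^ l) +
       real K ^ 2 * z powr (1 - \<epsilon> * sqrt n) + real K * (z powr (1 - (\<epsilon> * sqrt n - \<kappa> * sqrt n)) * q ^ l))"
    (is "_ \<le> _ + ennreal ?B")
proof -
  let ?S = "servers M N"
  have ne: "?S \<noteq> {}"
  proof
    assume "?S = {}"
    then have "(j, 0) \<notin> servers M N" for j by simp
    then have "N j = 0" if "j \<in> {1..M}" for j using that by (auto simp: servers_def)
    then show False using n by simp
  qed
  note law = sa_jsq_system_input_law[OF sys a dec ne]
  interpret prob_space P using sys by (simp add: sa_jsq_system_def)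
  interpret I: input_law M \<mu> N a "\<lambda>i. distr P borel (W i)" by (rule law(1))
  let ?W = "\<lambda>\<omega> i. W i \<omega>" and ?X = "\<lambda>\<omega>. restrict (X0 \<omega>) ?S"
  have Y_eq: "Y t \<omega> = - real (idle_fast M \<mu> N (?X \<omega>) (?W \<omega>) t) / sqrt n" for t \<omega>
    using M by (simp add: Y_def Y1_fast_eq_idle_fast idle_fast_restrict[OF ne])
  have Y_meas [measurable]: "Y 0 \<in> borel_measurable P"
    unfolding Y_def using M by (intro measurable_Y1_fast[OF _ ne sys law(2)]) simp
  have W_meas: "?W \<in> P \<rightarrow>\<^sub>M input_space" by (rule law(2))
  have law_W: "distr P input_space ?W = I.L" by (rule law(3))
  let ?idle0 = "\<lambda>x. card {s \<in> servers (M - 1) N. x s = 0}"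
  define covers where "covers x E \<longleftrightarrow> E \<in> sets input_space \<and> emeasure I.L E \<le> ennreal ?B \<and>
      (real (?idle0 x) \<le> \<kappa> * sqrt n \<longrightarrow>
        {w. \<exists>t\<in>{t0..T}. \<epsilon> * sqrt n < real (idle_fast M \<mu> N x w t)} \<subseteq> E)" for x E
  have "\<exists>E. covers x E" for x
  proof (cases "real (?idle0 x) \<le> \<kappa> * sqrt n")
    case True
    have tail: "emeasure I.L {w. t0 < epoch w l} \<le> ennreal (if l = 0 then 0 else exp (- (a / 2 * t0)) * 2 ^ l)"
      using t0 I.epoch_gt_tail[of t0 l] by (cases "l = 0") (simp_all add: epoch_def)
    have \<delta>: "0 \<le> (if l = 0 then 0 else exp (- (a / 2 * t0)) * 2 ^ l)" by simp
    show ?thesis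
      using I.excursion_bound[OF z cap q t0(1) \<theta> True tail \<delta>, where \<epsilon> = "\<epsilon> * sqrt n" and T = T and K = K]
      unfolding covers_def by (elim bexE conjE) (intro exI conjI impI)
  next
    case False
    then show ?thesis by (intro exI[of _ "{}"]) (auto simp: covers_def)
  qed
  then obtain E where E': "\<And>x. covers x (E x)" by metis
  have E: "E x \<in> sets input_space" "emeasure I.L (E x) \<le> ennreal ?B"
    "real (?idle0 x) \<le> \<kappa> * sqrt n \<Longrightarrow> t \<in> {t0..T} \<Longrightarrow> \<epsilon> * sqrt n < real (idle_fast M \<mu> N x w t) \<Longrightarrow> w \<in> E x" for x w t
    using E'[of x] unfolding covers_def by blast+
  let ?EX = "{\<omega> \<in> space P. ?W \<omega> \<in> E (?X \<omega>)}"
  have EX: "?EX \<in> sets P \<and> emeasure P ?EX \<le> ennreal ?B"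
  proof (rule emeasure_mixture_le[where K = input_space and I = "PiE ?S (\<lambda>_. UNIV)"
        and X = ?X and W = ?W and E = E])
    have "PiM ?S (\<lambda>_. count_space (UNIV :: nat set)) = count_space (PiE ?S (\<lambda>_. UNIV))"
      by (rule count_space_PiM_finite) auto
    then show "indep_set (sets (vimage_algebra (space P) ?X (count_space (PiE ?S (\<lambda>_. UNIV)))))
        (sets (vimage_algebra (space P) ?W input_space))"
      using sys by (simp add: sa_jsq_system_def)
    show "emeasure (distr P input_space ?W) (E x) \<le> ennreal ?B" for x
      using E(2)[of x] by (simp only: law_W)
    show "E x \<in> sets input_space" for x by (rule E(1))
  qed (fact prob_space_axioms W_meas countable_queue_lengths[OF finite_servers] measurable_restrict_initial[OF sys])+
  have "AE \<omega> in P. positive_inputs M N (?W \<omega>)"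
  proof -
    have "AE w in distr P input_space ?W. positive_inputs M N w"
      unfolding law_W by (rule I.AE_positive_inputs)
    from AE_distrD[OF W_meas this] show ?thesis .
  qed
  then obtain Z where Z: "{\<omega> \<in> space P. \<not> positive_inputs M N (?W \<omega>)} \<subseteq> Z" "emeasure P Z = 0" "Z \<in> sets P"
    by (rule AE_E)
  let ?Y0 = "{\<omega> \<in> space P. Y 0 \<omega> \<le> - \<kappa>}"
  have "{\<omega> \<in> space P. (SUP s\<in>{t0..T}. \<bar>Y s \<omega>\<bar>) > \<epsilon>} \<subseteq> (Z \<union> ?Y0) \<union> ?EX"
  proof (intro subsetI, rule ccontr)
    fix \<omega> assume "\<omega> \<in> {\<omega> \<in> space P. (SUP s\<in>{t0..T}. \<bar>Y s \<omega>\<bar>) > \<epsilon>}"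
      and not_in: "\<omega> \<notin> (Z \<union> ?Y0) \<union> ?EX"
    then have \<omega>: "\<omega> \<in> space P" and sup: "(SUP s\<in>{t0..T}. \<bar>Y s \<omega>\<bar>) > \<epsilon>" by auto
    then have "\<not> Y 0 \<omega> \<le> - \<kappa>" "\<omega> \<notin> Z" "?W \<omega> \<notin> E (?X \<omega>)" using not_in by auto
    have "\<exists>s\<in>{t0..T}. \<epsilon> < \<bar>Y s \<omega>\<bar>"
    proof (rule ccontr)
      assume "\<not> ?thesis"
      then have "(SUP s\<in>{t0..T}. \<bar>Y s \<omega>\<bar>) \<le> \<epsilon>"
        using t0 by (intro cSUP_least) (auto simp: not_less)
      then show False using sup by simp
    qed
    then obtain s where s: "s \<in> {t0..T}" "\<epsilon> < \<bar>Y s \<omega>\<bar>" by auto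
    have sn: "sqrt n > 0" using n by simp
    have "\<epsilon> * sqrt n < real (idle_fast M \<mu> N (?X \<omega>) (?W \<omega>) s)"
      using s(2) sn by (simp add: Y_eq pos_less_divide_eq)
    moreover have "real (?idle0 (?X \<omega>)) \<le> \<kappa> * sqrt n"
    proof -
      have "positive_inputs M N (?W \<omega>)" using Z(1) \<omega> \<open>\<omega> \<notin> Z\<close> by auto
      then interpret path: positive_path M \<mu> N "?X \<omega>" "?W \<omega>"
        using dec ne by (intro positive_path.intro)
      have "real (idle_fast M \<mu> N (?X \<omega>) (?W \<omega>) 0) < \<kappa> * sqrt n"
        using \<open>\<not> Y 0 \<omega> \<le> - \<kappa>\<close> sn by (simp add: Y_eq pos_divide_less_eq not_le)
      then show ?thesis using path.initially_idle_le by linarith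
    qed
    ultimately have "?W \<omega> \<in> E (?X \<omega>)" using E(3) s(1) by blast
    then show False using \<open>?W \<omega> \<notin> E (?X \<omega>)\<close> by contradiction
  qed
  then have "outer_measure_of P {\<omega> \<in> space P. (SUP s\<in>{t0..T}. \<bar>Y s \<omega>\<bar>) > \<epsilon>}
     \<le> outer_measure_of P ((Z \<union> ?Y0) \<union> ?EX)"
    by (rule outer_measure_of_mono)
  also have "\<dots> = emeasure P ((Z \<union> ?Y0) \<union> ?EX)"
    using Z(3) EX by (intro outer_measure_of_eq sets.Un) auto
  also have "\<dots> \<le> emeasure P Z + emeasure P ?Y0 + emeasure P ?EX"
    using Z(3) EX by (intro order_trans[OF emeasure_subadditive] add_mono order_refl) auto
  also have "\<dots> \<le> 0 + emeasure P ?Y0 + ennreal ?B"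
    using Z(2) EX by (intro add_mono) auto
  also have "emeasure P ?Y0 = ennreal (cdf (distr P borel (Y 0)) (- \<kappa>))"
    unfolding cdf_def by (subst measure_distr) (auto simp: emeasure_eq_measure vimage_def Int_def conj_commute)
  finally show ?thesis by simp
qed

section \<open>The many-server limit\<close>

lemma polynomial_times_exp_sqrt_tendsto_0:
  assumes "c > (0 :: real)"
  shows "(\<lambda>n. real n ^ 2 * exp (- c * sqrt (real n))) \<longlonglongrightarrow> 0"
  using assms by real_asymp

lemma exp_sqrt_minus_linear_tendsto_0:
  assumes "c > (0 :: real)" "k > 0"
  shows "(\<lambda>n. real n * exp (k * sqrt (real n) - c * real n)) \<longlonglongrightarrow> 0"
  using assms by real_asymp

text \<open>
  The form in which tightness of the initial values is used: the first part of the bound converges to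
  a limit that can be made small by the choice of \<open>\<kappa>\<close>, and the second part vanishes for every \<open>\<kappa>\<close>.
\<close>

lemma ennreal_tendsto_0_by_splitting:
  fixes f :: "nat \<Rightarrow> ennreal"
  assumes "\<And>\<eta>. \<eta> > 0 \<Longrightarrow> \<exists>A B :: nat \<Rightarrow> real. \<exists>x. x < \<eta> \<and> A \<longlonglongrightarrow> x \<and> B \<longlonglongrightarrow> 0 \<and>
    (\<forall>\<^sub>F n in sequentially. f n \<le> ennreal (A n) + ennreal (B n))"
  shows "f \<longlonglongrightarrow> 0"
proof (rule order_tendstoI)
  fix y :: ennreal assume "0 < y"
  then obtain e where e: "0 < e" "e < y" using dense by blast
  then obtain \<eta> where \<eta>: "e = ennreal \<eta>" "\<eta> > 0" by (cases e) (auto simp: ennreal_less_zero_iff)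
  from assms[of "\<eta> / 2"] \<eta> obtain A B x where x: "x < \<eta> / 2" "A \<longlonglongrightarrow> x" "B \<longlonglongrightarrow> 0"
    and le: "\<forall>\<^sub>F n in sequentially. f n \<le> ennreal (A n) + ennreal (B n)" by auto
  have "\<forall>\<^sub>F n in sequentially. A n < \<eta> / 2" "\<forall>\<^sub>F n in sequentially. B n < \<eta> / 2"
    using order_tendstoD(2)[OF x(2,1)] order_tendstoD(2)[OF x(3), of "\<eta> / 2"] \<eta> by auto
  with le show "\<forall>\<^sub>F n in sequentially. f n < y"
  proof eventually_elim
    case (elim n)
    have "f n \<le> ennreal (\<eta> / 2) + ennreal (\<eta> / 2)"
      using elim by (intro order_trans[OF elim(1)] add_mono ennreal_leI) auto
    also have "\<dots> = e" using \<eta> by (simp flip: ennreal_plus)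
    finally show ?case using e by simp
  qed
qed simp

lemma (in real_distribution) small_cdf_continuity_point:
  assumes "\<eta> > 0"
  shows "\<exists>\<kappa>>0. isCont (cdf M) (- \<kappa>) \<and> cdf M (- \<kappa>) < \<eta>"
proof -
  have "\<forall>\<^sub>F x in at_bot. cdf M x < \<eta>"
    by (rule order_tendstoD(2)[OF cdf_lim_at_bot assms])
  then obtain b where b: "\<And>x. x \<le> b \<Longrightarrow> cdf M x < \<eta>" by (auto simp: eventually_at_bot_linorder)
  have "countable {x. \<not> isCont (cdf M) x}"
    by (intro mono_ctble_discont monoI cdf_nondecreasing)
  moreover define y where "y = min b 0"
  have "uncountable {y - 1<..<y}"
    unfolding uncountable_open_interval by linarith
  ultimately have "\<not> {y - 1<..<y} \<subseteq> {x. \<not> isCont (cdf M) x}"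
    using countable_subset by blast
  then obtain x where "x < y" "isCont (cdf M) x" by auto
  then have "x < b" "x < 0" by (auto simp: y_def)
  then show ?thesis using b[of x] \<open>isCont (cdf M) x\<close> by (intro exI[of _ "- x"]) auto
qed

lemma cdf_return_0:
  assumes "\<kappa> > 0"
  shows "isCont (cdf (return borel 0)) (- \<kappa>)" "cdf (return borel 0) (- \<kappa>) = 0"
proof -
  have neg: "cdf (return borel 0) x = 0" if "x < 0" for x
    using that by (simp add: cdf_def measure_return)
  then show "cdf (return borel 0) (- \<kappa>) = 0" using assms by simp
  have "\<forall>\<^sub>F x in nhds (- \<kappa>). cdf (return borel 0) x = 0"
    using eventually_nhds_in_open[of "{..<0}" "- \<kappa>"] assms by (auto elim!: eventually_mono intro: neg)
  then have "isCont (cdf (return borel 0)) (- \<kappa>) = isCont (\<lambda>_. 0 :: real) (- \<kappa>)"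
    by (rule isCont_cong)
  then show "isCont (cdf (return borel 0)) (- \<kappa>)" by simp
qed


text \<open>
  The load \<open>b < 1\<close> of the fast servers leaves room for a slightly larger load \<open>\<rho> < 1\<close> and a base \<open>z > 1\<close>
  with \<open>z \<rho> < 1\<close>. The latter says that \<open>z (1 - (z - 1) \<rho>) > 1\<close>, and \<open>q\<close> is the inverse of this number.
\<close>

lemma geometric_ratio_exists:
  assumes "0 \<le> b" "b < (1 :: real)"
  shows "\<exists>\<rho> z q. b < \<rho> \<and> 0 < \<rho> \<and> 1 < z \<and> (z - 1) * \<rho> < 1 \<and> 0 < q \<and> q < 1 \<and> z * q = 1 / (1 - (z - 1) * \<rho>)"
proof -
  define \<rho> where "\<rho> = (1 + b) / 2"
  define z where "z = 2 / (1 + \<rho>)"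
  have \<rho>: "b < \<rho>" "0 < \<rho>" "\<rho> < 1" using assms by (auto simp: \<rho>_def)
  have z: "1 < z" "z * \<rho> < 1" using \<rho> by (auto simp: z_def field_simps)
  then have c: "(z - 1) * \<rho> < 1" using \<rho> by (simp add: algebra_simps)
  have "(z - 1) * (z * \<rho>) < (z - 1) * 1" using z by (intro mult_strict_left_mono) auto
  then have "1 < z * (1 - (z - 1) * \<rho>)" by (simp add: algebra_simps)
  then have "0 < 1 / (z * (1 - (z - 1) * \<rho>))" "1 / (z * (1 - (z - 1) * \<rho>)) < 1"
    "z * (1 / (z * (1 - (z - 1) * \<rho>))) = 1 / (1 - (z - 1) * \<rho>)"
    using z by (auto simp: divide_simps)
  with \<rho> z c show ?thesis by blast
qed

lemma tendsto_of_scaled_diff: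
  fixes x :: "nat \<Rightarrow> real"
  assumes "(\<lambda>n. sqrt (real n) * \<bar>x n - c\<bar>) \<longlonglongrightarrow> 0"
  shows "x \<longlonglongrightarrow> c"
proof -
  have "(\<lambda>n. x n - c) \<longlonglongrightarrow> 0"
  proof (rule Lim_null_comparison[OF _ assms])
    have "\<bar>x n - c\<bar> \<le> sqrt (real n) * \<bar>x n - c\<bar>" if "1 \<le> n" for n
      using that mult_right_mono[of 1 "sqrt (real n)" "\<bar>x n - c\<bar>"] by simp
    then show "\<forall>\<^sub>F n in sequentially. norm (x n - c) \<le> sqrt (real n) * \<bar>x n - c\<bar>"
      unfolding eventually_sequentially by (intro exI[of _ 1]) simp
  qed
  then show ?thesis by (simp add: LIM_zero_iff)
qed

(* The exceedance probability is written with outer_measure_of, which is the probability itself on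
   measurable events; thus the conclusion cannot hold merely because the measure function returns 0
   on a set that is not measurable. The system with index n = 0 is unconstrained and irrelevant. *)
theorem proposition3p1:
  fixes M :: nat and \<mu> \<gamma> :: "nat \<Rightarrow> real" and \<beta> :: real
    and lam :: "nat \<Rightarrow> real" and N :: "nat \<Rightarrow> nat \<Rightarrow> nat"
    and P :: "nat \<Rightarrow> 'a measure" and X0 :: "nat \<Rightarrow> 'a \<Rightarrow> server \<Rightarrow> nat"
    and W :: "nat \<Rightarrow> input \<Rightarrow> 'a \<Rightarrow> real"
    and Y :: "nat \<Rightarrow> real \<Rightarrow> 'a \<Rightarrow> real"
    and P_lim :: "'b measure" and Y0 :: "'b \<Rightarrow> real"
  assumes "M \<ge> 2"
    and "\<And>i j. 1 \<le> i \<Longrightarrow> i < j \<Longrightarrow> j \<le> M \<Longrightarrow> \<mu> j < \<mu> i"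
    and "\<mu> M > 0"
    and "\<And>j. j \<in> {1..M} \<Longrightarrow> \<gamma> j > 0"
    and "(\<Sum>j = 1..M. \<mu> j * \<gamma> j) = 1"
    and "\<And>n. n \<ge> 1 \<Longrightarrow> (\<Sum>j = 1..M. N n j) = n"
    and "\<And>n. n \<ge> 1 \<Longrightarrow> 0 < lam n \<and> lam n < 1"
    and "\<And>n. n \<ge> 1 \<Longrightarrow> sa_jsq_system M \<mu> (N n) (real n * lam n) (P n) (X0 n) (W n)"
    and Y_def: "\<And>n t \<omega>. Y n t \<omega> = Y1_fast M \<mu> n (N n) (X0 n \<omega>) (\<lambda>i. W n i \<omega>) t"
    and "\<beta> > 0"
    and "(\<lambda>n. sqrt (real n) * (1 - lam n)) \<longlonglongrightarrow> \<beta>"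
    and "\<And>j. j \<in> {1..M} \<Longrightarrow> (\<lambda>n. sqrt (real n) * \<bar>real (N n j) / real n - \<gamma> j\<bar>) \<longlonglongrightarrow> 0"
    and "prob_space P_lim" and "Y0 \<in> borel_measurable P_lim"
    and "weak_conv_m (\<lambda>n. distr (P n) borel (Y n 0)) (distr P_lim borel Y0)"
  shows "(\<forall>\<epsilon>>0. \<forall>t0>0. \<forall>T\<ge>t0.
            (\<lambda>n. outer_measure_of (P n)
                   {\<omega> \<in> space (P n). (SUP s\<in>{t0..T}. \<bar>Y n s \<omega>\<bar>) > \<epsilon>}) \<longlonglongrightarrow> 0) \<and>
         (weak_conv_m (\<lambda>n. distr (P n) borel (Y n 0)) (return borel 0) \<longrightarrow>
          (\<forall>\<epsilon>>0. \<forall>T\<ge>0.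
            (\<lambda>n. outer_measure_of (P n)
                   {\<omega> \<in> space (P n). (SUP s\<in>{0..T}. \<bar>Y n s \<omega>\<bar>) > \<epsilon>}) \<longlonglongrightarrow> 0))"
proof -
  note dec = assms(2) and sum_N = assms(6) and lam = assms(7) and sys = assms(8)
  have M: "M \<ge> 2" by fact
  have \<mu>_pos: "0 < \<mu> j" if "j \<in> {1..M}" for j
    using that dec[of j M] \<open>\<mu> M > 0\<close> by (cases "j = M") auto
  define R where "R n = (\<Sum>s\<in>servers (M - 1) (N n). \<mu> (fst s))" for n
  define b where "b = (\<Sum>j = 1..M - 1. \<gamma> j * \<mu> j)"
  have R_eq: "R n = (\<Sum>j = 1..M - 1. real (N n j) * \<mu> j)" for n
    unfolding R_def by (rule sum_servers)
  have "{1..M} = insert M {1..M - 1}" using M by auto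
  then have "b + \<mu> M * \<gamma> M = 1"
    using assms(5) M by (simp add: b_def mult.commute)
  moreover have "0 < \<mu> M * \<gamma> M" using assms(3,4) M by simp
  moreover have "0 \<le> b"
    unfolding b_def using assms(4) \<mu>_pos by (intro sum_nonneg mult_nonneg_nonneg) (auto simp: less_imp_le)
  ultimately have b: "0 \<le> b" "b < 1" by auto
  then obtain \<rho> z q where rz: "b < \<rho>" "0 < \<rho>" "1 < z" "(z - 1) * \<rho> < 1" "0 < q" "q < 1"
    "z * q = 1 / (1 - (z - 1) * \<rho>)"
    using geometric_ratio_exists by metis
  have lam_lim: "lam \<longlonglongrightarrow> 1"
  proof -
    have "(\<lambda>n. sqrt (real n) * (1 - lam n) / sqrt (real n)) \<longlonglongrightarrow> 0"
      by (rule real_tendsto_divide_at_top[OF assms(11)])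
         (intro filterlim_compose[OF sqrt_at_top] filterlim_real_sequentially)
    moreover have "\<forall>\<^sub>F n in sequentially. sqrt (real n) * (1 - lam n) / sqrt (real n) = 1 - lam n"
      using eventually_gt_at_top[of 0] by eventually_elim simp
    ultimately have "(\<lambda>n. 1 - lam n) \<longlonglongrightarrow> 0"
      by (rule Lim_transform_eventually)
    then show ?thesis using tendsto_diff[OF tendsto_const[of 1], of "\<lambda>n. 1 - lam n" 0] by simp
  qed
  have "(\<lambda>n. (\<Sum>j = 1..M - 1. real (N n j) / real n * \<mu> j) - \<rho> * lam n) \<longlonglongrightarrow> (\<Sum>j = 1..M - 1. \<gamma> j * \<mu> j) - \<rho> * 1"
    by (intro tendsto_intros lam_lim tendsto_of_scaled_diff[OF assms(12)]) auto
  then have "\<forall>\<^sub>F n in sequentially. (\<Sum>j = 1..M - 1. real (N n j) / real n * \<mu> j) - \<rho> * lam n < 0"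
    using rz(1) by (intro order_tendstoD(2)) (auto simp: b_def)
  moreover have "\<forall>\<^sub>F n in sequentially. 1 / 2 < lam n"
    by (rule order_tendstoD(1)[OF lam_lim]) simp
  ultimately have good: "\<forall>\<^sub>F n in sequentially. n \<ge> 1 \<and> 1 / 2 < lam n \<and> R n \<le> \<rho> * (real n * lam n)"
    using eventually_ge_at_top[of 1]
  proof eventually_elim
    case (elim n)
    have "R n = real n * (\<Sum>j = 1..M - 1. real (N n j) / real n * \<mu> j)"
      using elim(3) by (simp add: R_eq sum_distrib_left)
    also have "\<dots> \<le> real n * (\<rho> * lam n)"
      using elim(1) by (intro mult_left_mono) auto
    finally show ?case using elim by (simp add: mult_ac)
  qed
  let ?f = "\<lambda>\<epsilon> t0 T n. outer_measure_of (P n) {\<omega> \<in> space (P n). (SUP s\<in>{t0..T}. \<bar>Y n s \<omega>\<bar>) > \<epsilon>}"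
  let ?c = "\<lambda>\<kappa> n. cdf (distr (P n) borel (Y n 0)) (- \<kappa>)"
  have main: "\<exists>k. \<forall>\<epsilon> \<kappa> l. 0 < \<kappa> \<longrightarrow> (\<forall>\<^sub>F n in sequentially. ?f \<epsilon> t0 T n \<le> ennreal (?c \<kappa> n) +
      ennreal ((1/2) ^ n + (if l n = 0 then 0 else exp (- (real n * t0 / 4)) * 2 ^ l n) +
       real k ^ 2 * z * (real n ^ 2 * exp (- (\<epsilon> * ln z) * sqrt (real n))) +
       real k * z * (real n * (exp (- ((\<epsilon> - \<kappa>) * ln z) * sqrt (real n)) * q ^ l n))))"
    if t: "0 \<le> t0" "t0 \<le> T" for t0 T
  proof -
    \<comment> \<open>\<open>n k\<close> jobs suffice to cover \<open>[0, T]\<close>: with \<open>\<theta> = n\<close> the Chernoff bound is at most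
        \<open>(exp T / 2 ^ k) ^ n\<close>.\<close>
    obtain k where k: "2 * exp T < 2 ^ k" using real_arch_pow[of 2] by auto
    have "\<forall>\<^sub>F n in sequentially. ?f \<epsilon> t0 T n \<le> ennreal (?c \<kappa> n) +
      ennreal ((1/2) ^ n + (if l n = 0 then 0 else exp (- (real n * t0 / 4)) * 2 ^ l n) +
       real k ^ 2 * z * (real n ^ 2 * exp (- (\<epsilon> * ln z) * sqrt (real n))) +
       real k * z * (real n * (exp (- ((\<epsilon> - \<kappa>) * ln z) * sqrt (real n)) * q ^ l n)))"
      if \<kappa>: "0 < \<kappa>" for \<epsilon> \<kappa> and l :: "nat \<Rightarrow> nat"
      using good
    proof eventually_elim
      case (elim n)
      let ?a = "real n * lam n"
      have n: "n \<ge> 1" and a: "0 < ?a" using elim lam[of n] by auto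
      have "(z - 1) * R n \<le> (z - 1) * (\<rho> * ?a)"
        using elim rz by (intro mult_left_mono) auto
      then have capR: "(z - 1) * R n \<le> ((z - 1) * \<rho>) * ?a" by (simp only: mult.assoc)
      also have "\<dots> < 1 * ?a" using rz a by (intro mult_strict_right_mono) auto
      finally have cap: "(z - 1) * R n < ?a" by simp
      have "?a / (?a - (z - 1) * R n) \<le> ?a / (?a - ((z - 1) * \<rho>) * ?a)"
        using capR cap a rz \<open>(z - 1) * \<rho> * ?a < 1 * ?a\<close> by (intro divide_left_mono mult_pos_pos) auto
      also have "?a - ((z - 1) * \<rho>) * ?a = ?a * (1 - (z - 1) * \<rho>)" by (simp add: algebra_simps)
      also have "?a / (?a * (1 - (z - 1) * \<rho>)) = z * q"
        using a by (simp only: rz(7) nonzero_divide_mult_cancel_left less_imp_neq[THEN not_sym] not_False_eq_True)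
      finally have qq: "?a / (?a - (z - 1) * R n) \<le> z * q" .
      have 1: "exp (real n * T) * (?a / (?a + real n)) ^ (n * k) \<le> (1/2) ^ n"
      proof -
        have "?a / (?a + real n) \<le> 1/2"
        proof -
          have "?a \<le> real n" using lam[OF n] by (simp add: mult_left_le)
          then show ?thesis using a by (subst pos_divide_le_eq) auto
        qed
        then have "(?a / (?a + real n)) ^ (n * k) \<le> (1/2) ^ (n * k)"
          using a by (intro power_mono) auto
        then have "exp (real n * T) * (?a / (?a + real n)) ^ (n * k) \<le> exp T ^ n * ((1/2) ^ k) ^ n"
          unfolding exp_of_nat_mult power_mult[symmetric] mult.commute[of k n]
          by (rule mult_left_mono) simp
        also have "\<dots> = (exp T / 2 ^ k) ^ n" by (simp add: power_divide power_mult_distrib[symmetric])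
        also have "\<dots> \<le> (1/2) ^ n" using k by (intro power_mono) (auto simp: field_simps)
        finally show ?thesis .
      qed
      have 2: "(if l n = 0 then 0 else exp (- (?a / 2 * t0)) * 2 ^ l n)
          \<le> (if l n = 0 then 0 else exp (- (real n * t0 / 4)) * 2 ^ l n :: real)"
      proof -
        have "real n * t0 * (1/2) \<le> real n * t0 * lam n"
          using elim t n by (intro mult_left_mono) auto
        then show ?thesis by (simp add: algebra_simps)
      qed
      have powr: "z powr (1 - x) = z * exp (- x * ln z)" for x
      proof -
        have "(1 - x) * ln z = ln z + - x * ln z" by (simp add: algebra_simps)
        then have "exp ((1 - x) * ln z) = exp (ln z) * exp (- x * ln z)" by (simp only: exp_add)
        then show ?thesis using rz(3) by (simp add: powr_def)
      qed
      have 3: "real (n * k) ^ 2 * z powr (1 - \<epsilon> * sqrt n) = real k ^ 2 * z * (real n ^ 2 * exp (- (\<epsilon> * ln z) * sqrt (real n)))"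
        unfolding powr by (simp add: power_mult_distrib mult_ac)
      have 4: "real (n * k) * (z powr (1 - (\<epsilon> * sqrt n - \<kappa> * sqrt n)) * q ^ l n)
          = real k * z * (real n * (exp (- ((\<epsilon> - \<kappa>) * ln z) * sqrt (real n)) * q ^ l n))"
        unfolding powr by (simp add: algebra_simps)
      have "?f \<epsilon> t0 T n \<le> ennreal (?c \<kappa> n) +
        ennreal (exp (real n * T) * (?a / (?a + real n)) ^ (n * k) +
          (if l n = 0 then 0 else exp (- (?a / 2 * t0)) * 2 ^ l n) +
          real (n * k) ^ 2 * z powr (1 - \<epsilon> * sqrt n) +
          real (n * k) * (z powr (1 - (\<epsilon> * sqrt n - \<kappa> * sqrt n)) * q ^ l n))"
        unfolding Y_def
        using system_exceedance_bound[OF M n sum_N[OF n] sys[OF n] a \<mu>_pos dec \<open>1 < z\<close>, of q t0 T "real n" \<kappa> \<epsilon> "n * k" "l n"]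
          cap qq rz t n \<kappa> by (simp add: R_def)
      also have "\<dots> \<le> ennreal (?c \<kappa> n) +
        ennreal ((1/2) ^ n + (if l n = 0 then 0 else exp (- (real n * t0 / 4)) * 2 ^ l n) +
         real k ^ 2 * z * (real n ^ 2 * exp (- (\<epsilon> * ln z) * sqrt (real n))) +
         real k * z * (real n * (exp (- ((\<epsilon> - \<kappa>) * ln z) * sqrt (real n)) * q ^ l n)))"
        unfolding 3 4 by (intro add_left_mono ennreal_leI add_right_mono add_mono 1 2)
      finally show ?case .
    qed
    then show ?thesis by blast
  qed
  have half: "(\<lambda>n. (1/2 :: real) ^ n) \<longlonglongrightarrow> 0" by (rule LIMSEQ_power_zero) simp
  show ?thesis
  proof (intro conjI allI impI)
    fix \<epsilon> t0 T :: real assume \<epsilon>: "\<epsilon> > 0" and t0: "t0 > 0" "T \<ge> t0"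
    obtain k where k: "\<And>\<kappa> l. 0 < \<kappa> \<Longrightarrow> \<forall>\<^sub>F n in sequentially. ?f \<epsilon> t0 T n \<le> ennreal (?c \<kappa> n) +
      ennreal ((1/2) ^ n + (if l n = 0 then 0 else exp (- (real n * t0 / 4)) * 2 ^ l n) +
       real k ^ 2 * z * (real n ^ 2 * exp (- (\<epsilon> * ln z) * sqrt (real n))) +
       real k * z * (real n * (exp (- ((\<epsilon> - \<kappa>) * ln z) * sqrt (real n)) * q ^ l n)))"
      using main[of t0 T] t0 by (meson less_imp_le)
    \<comment> \<open>About \<open>n t0\<close> jobs arrive before \<open>t0\<close>, and \<open>n c\<close> is a small enough fraction of them for the
        Chernoff bound; the \<open>sqrt n\<close> initially idle servers are occupied long before.\<close>
    define c where "c = t0 / 8"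
    define l where "l n = nat \<lfloor>real n * c\<rfloor>" for n
    have l: "real n * c - 1 \<le> real (l n)" "real (l n) \<le> real n * c" for n
    proof -
      have "0 \<le> real n * c" using t0 by (simp add: c_def)
      then have "real (l n) = of_int \<lfloor>real n * c\<rfloor>" by (simp add: l_def)
      then show "real n * c - 1 \<le> real (l n)" "real (l n) \<le> real n * c" by linarith+
    qed
    show "?f \<epsilon> t0 T \<longlonglongrightarrow> 0"
    proof (rule ennreal_tendsto_0_by_splitting)
      fix \<eta> :: real assume "\<eta> > 0"
      interpret lim: prob_space P_lim by fact
      interpret Y0: real_distribution "distr P_lim borel Y0" using assms(14) by simp
      obtain \<kappa> where \<kappa>: "0 < \<kappa>" "isCont (cdf (distr P_lim borel Y0)) (- \<kappa>)" "cdf (distr P_lim borel Y0) (- \<kappa>) < \<eta>"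
        using Y0.small_cdf_continuity_point[OF \<open>\<eta> > 0\<close>] by auto
      have "?c \<kappa> \<longlonglongrightarrow> cdf (distr P_lim borel Y0) (- \<kappa>)"
        using assms(15) \<kappa>(2) by (simp add: weak_conv_m_def weak_conv_def)
      moreover define B where "B n = (1/2) ^ n + exp (- (real n * c)) +
         real k ^ 2 * z * (real n ^ 2 * exp (- (\<epsilon> * ln z) * sqrt (real n))) +
         real k * z * (1 / q * (real n * exp (\<kappa> * ln z * sqrt (real n) - (- ln q * c) * real n)))" for n
      have "B \<longlonglongrightarrow> 0 + 0 + real k ^ 2 * z * 0 + real k * z * (1 / q * 0)"
        unfolding B_def
      proof (intro tendsto_add tendsto_mult_left half)
        have "0 < c" using t0 by (simp add: c_def)
        then show "(\<lambda>n. exp (- (real n * c))) \<longlonglongrightarrow> 0" by real_asymp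
        show "(\<lambda>n. real n ^ 2 * exp (- (\<epsilon> * ln z) * sqrt (real n))) \<longlonglongrightarrow> 0"
          using \<epsilon> rz by (intro polynomial_times_exp_sqrt_tendsto_0) simp
        show "(\<lambda>n. real n * exp (\<kappa> * ln z * sqrt (real n) - (- ln q * c) * real n)) \<longlonglongrightarrow> 0"
          using \<kappa> rz \<open>0 < c\<close> by (intro exp_sqrt_minus_linear_tendsto_0) (auto simp: mult_neg_pos)
      qed
      then have "B \<longlonglongrightarrow> 0" by simp
      moreover have "\<forall>\<^sub>F n in sequentially. ?f \<epsilon> t0 T n \<le> ennreal (?c \<kappa> n) + ennreal (B n)"
        using k[OF \<kappa>(1), of l]
      proof eventually_elim
        case (elim n)
        have 1: "(if l n = 0 then 0 else exp (- (real n * t0 / 4)) * 2 ^ l n) \<le> exp (- (real n * c))"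
        proof -
          have "(2 :: real) ^ l n \<le> exp 1 ^ l n" using exp_ge_add_one_self[of 1] by (intro power_mono) auto
          also have "\<dots> = exp (real (l n))" by (simp add: exp_of_nat_mult[symmetric])
          also have "\<dots> \<le> exp (real n * c)" using l by simp
          finally have "exp (- (real n * t0 / 4)) * 2 ^ l n \<le> exp (- (real n * t0 / 4)) * exp (real n * c)"
            by (intro mult_left_mono) auto
          also have "\<dots> = exp (- (real n * c))" by (simp add: c_def flip: exp_add)
          finally show ?thesis by simp
        qed
        have 2: "exp (- ((\<epsilon> - \<kappa>) * ln z) * sqrt (real n)) * q ^ l n
           \<le> 1 / q * exp (\<kappa> * ln z * sqrt (real n) - (- ln q * c) * real n)"
        proof -
          have "q ^ l n = exp (ln q * real (l n))" using rz by (simp add: exp_of_nat2_mult)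
          also have "\<dots> \<le> exp (ln q * (real n * c - 1))"
            using rz l[of n] by (simp add: mult_left_mono_neg)
          also have "\<dots> = 1 / q * exp (- (- ln q * c) * real n)"
            using rz by (simp add: algebra_simps exp_diff)
          finally have "q ^ l n \<le> 1 / q * exp (- (- ln q * c) * real n)" .
          moreover have "0 \<le> \<epsilon> * ln z * sqrt (real n)" using \<epsilon> rz by simp
          then have "exp (- ((\<epsilon> - \<kappa>) * ln z) * sqrt (real n)) \<le> exp (\<kappa> * ln z * sqrt (real n))"
            by (simp add: algebra_simps)
          ultimately have "exp (- ((\<epsilon> - \<kappa>) * ln z) * sqrt (real n)) * q ^ l n
             \<le> exp (\<kappa> * ln z * sqrt (real n)) * (1 / q * exp (- (- ln q * c) * real n))"
            using rz by (intro mult_mono) auto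
          also have "\<dots> = 1 / q * (exp (\<kappa> * ln z * sqrt (real n)) * exp (- (- ln q * c) * real n))"
            by simp
          also have "\<dots> = 1 / q * exp (\<kappa> * ln z * sqrt (real n) - (- ln q * c) * real n)"
            unfolding exp_add[symmetric] by simp
          finally show ?thesis .
        qed
        have "real n * (exp (- ((\<epsilon> - \<kappa>) * ln z) * sqrt (real n)) * q ^ l n)
          \<le> 1 / q * (real n * exp (\<kappa> * ln z * sqrt (real n) - (- ln q * c) * real n))"
          using mult_left_mono[OF 2, of "real n"] by (simp add: mult_ac)
        then show ?case
          unfolding B_def using rz 1
          by (intro order_trans[OF elim] add_left_mono ennreal_leI add_mono order_refl mult_left_mono) auto
      qed
      ultimately show "\<exists>A B x. x < \<eta> \<and> A \<longlonglongrightarrow> x \<and> B \<longlonglongrightarrow> 0 \<and>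
          (\<forall>\<^sub>F n in sequentially. ?f \<epsilon> t0 T n \<le> ennreal (A n) + ennreal (B n))"
        using \<kappa>(3) by blast
    qed
  next
    assume conv: "weak_conv_m (\<lambda>n. distr (P n) borel (Y n 0)) (return borel 0)"
    fix \<epsilon> T :: real assume \<epsilon>: "\<epsilon> > 0" and T: "T \<ge> 0"
    obtain k where k: "\<And>\<kappa> l. 0 < \<kappa> \<Longrightarrow> \<forall>\<^sub>F n in sequentially. ?f \<epsilon> 0 T n \<le> ennreal (?c \<kappa> n) +
      ennreal ((1/2) ^ n + (if l n = 0 then 0 else exp (- (real n * 0 / 4)) * 2 ^ l n) +
       real k ^ 2 * z * (real n ^ 2 * exp (- (\<epsilon> * ln z) * sqrt (real n))) +
       real k * z * (real n * (exp (- ((\<epsilon> - \<kappa>) * ln z) * sqrt (real n)) * q ^ l n)))"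
      using main[of 0 T] T by (meson order_refl)
    \<comment> \<open>Starting from \<open>\<epsilon> / 2\<close>, the first excursion still has to climb by \<open>\<epsilon> / 2\<close>; this is
        exponentially unlikely from time \<open>0\<close> on.\<close>
    define \<kappa> where "\<kappa> = \<epsilon> / 2"
    have \<kappa>: "0 < \<kappa>" "\<epsilon> - \<kappa> = \<kappa>" using \<epsilon> by (auto simp: \<kappa>_def)
    define B where "B n = (1/2) ^ n +
         real k ^ 2 * z * (real n ^ 2 * exp (- (\<epsilon> * ln z) * sqrt (real n))) +
         real k * z * (real n ^ 2 * exp (- (\<kappa> * ln z) * sqrt (real n)))" for n
    have "B \<longlonglongrightarrow> 0 + real k ^ 2 * z * 0 + real k * z * 0"
      unfolding B_def using \<epsilon> \<kappa> rz
      by (intro tendsto_add tendsto_mult_left half polynomial_times_exp_sqrt_tendsto_0) auto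
    then have B: "B \<longlonglongrightarrow> 0" by simp
    have A: "?c \<kappa> \<longlonglongrightarrow> 0"
      using conv[unfolded weak_conv_m_def weak_conv_def, rule_format, OF cdf_return_0(1)[OF \<kappa>(1)]]
      unfolding cdf_return_0(2)[OF \<kappa>(1)] .
    have le: "\<forall>\<^sub>F n in sequentially. ?f \<epsilon> 0 T n \<le> ennreal (?c \<kappa> n) + ennreal (B n)"
      using k[OF \<kappa>(1), of "\<lambda>_. 0"]
    proof eventually_elim
      case (elim n)
      have "real n \<le> real n ^ 2" by (cases n) (auto simp: power2_eq_square)
      then have "real n * exp (- (\<kappa> * ln z) * sqrt (real n)) \<le> real n ^ 2 * exp (- (\<kappa> * ln z) * sqrt (real n))"
        by (intro mult_right_mono) auto
      then show ?case
        unfolding B_def using rz elim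
        by (intro order_trans[OF elim] add_left_mono ennreal_leI) (simp add: \<kappa>(2) mult_left_mono)
    qed
    show "?f \<epsilon> 0 T \<longlonglongrightarrow> 0"
      by (rule ennreal_tendsto_0_by_splitting) (use A B le in blast)
  qed
qed

end
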